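(* Let $n\in\mathbb N$, let $K_1,\dots,K_n$ be singular kernel functions each satisfying (PM$_c$) for some constant $c>0$, and let $J$ be an arbitrary $n$-field function. Then the restriction $\Phi|_Y:Y\to\mathbb R^n$ of the difference function, $$\Phi(\mathbf x)=\bigl(m_1(\mathbf x)-m_0(\mathbf x),\,m_2(\mathbf x)-m_1(\mathbf x),\,\dots,\,m_n(\mathbf x)-m_{n-1}(\mathbf x)\bigr),$$ is a homeomorphism of $Y$ onto $\mathbb R^n$. Moreover, $\Phi|_Y$ is locally bi-Lipschitz.
   Context: Fix $n\in\mathbb N$. A kernel function is a function $K:(-1,0)\cup(0,1)\to\mathbb R$ that is concave on $(-1,0)$ and concave on $(0,1)$ and satisfies $\lim_{t\downarrow0}K(t)=\lim_{t\uparrow0}K(t)$. It is extended to $[-1,1]$ with values in $[-\infty,\infty)$ by setting $K(0):=\lim_{t\to0}K(t)$, $K(-1):=\lim_{t\downarrow-1}K(t)$ and $K(1):=\lim_{t\uparrow1}K(t)$; these limits exist by concavity. A kernel function is singular if $K(0)=-\infty$. For $c\ge0$, a kernel function $K$ satisfies (PM$_c$) if $K'(t)-K'(t-1)\ge c$ for almost every $t\in(0,1)$. An $n$-field function is a function $J:[0,1]\to[-\infty,\infty)$ that is bounded above and whose set of finite values $\{t:J(t)>-\infty\}$ has total weight strictly greater than $n$. Here the points $0$ and $1$ each have weight $1/2$ and every point of $(0,1)$ has weight $1$. Let $S=\{\mathbf y\in\mathbb R^n:0<y_1<\dots<y_n<1\}$ and let $\overline S$ be its closure. For kernel functions $K_1,\dots,K_n$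 and an $n$-field function $J$, put $$F(\mathbf y,t)=J(t)+\sum_{j=1}^nK_j(t-y_j),\qquad \mathbf y\in\overline S,\ t\in[0,1],$$ with the convention $a+(-\infty)=-\infty$. Set $y_0:=0$ and $y_{n+1}:=1$. For $j=0,\dots,n$ let $I_j(\mathbf y)=[y_j,y_{j+1}]$ and $m_j(\mathbf y)=\sup_{t\in I_j(\mathbf y)}F(\mathbf y,t)\in[-\infty,\infty)$. The regularity set is $Y=\{\mathbf y\in S: m_j(\mathbf y)\ne-\infty\text{ for all }j=0,\dots,n\}$. When all kernels are singular, $Y$ equals $\{\mathbf y\in S:\operatorname{rint}I_j(\mathbf y)\not\subseteq X\ \forall j\}$, where $X=\{t\in[0,1]:J(t)=-\infty\}$ and $\operatorname{rint}$ denotes the interior relative to $[0,1]$. The difference function is $\Phi(\mathbf y)=(m_1(\mathbf y)-m_0(\mathbf y),\dots,m_n(\mathbf y)-m_{n-1}(\mathbf y))$. *)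

theory Defs
  imports "HOL-Analysis.Analysis"
begin

text \<open>Kernel functions are modelled as K :: real => real; only the values on
  (-1,0) and (0,1) matter.  The extension to [-1,1] with values in [-inf,inf)
  is kext K.\<close>

definition kernel_function :: "(real \<Rightarrow> real) \<Rightarrow> bool" where
  "kernel_function K \<longleftrightarrow>
     concave_on {-1<..<0} K \<and> concave_on {0<..<1} K \<and>
     Lim (at_right 0) (\<lambda>t. ereal (K t)) = Lim (at_left 0) (\<lambda>t. ereal (K t))"

definition kext :: "(real \<Rightarrow> real) \<Rightarrow> real \<Rightarrow> ereal" where
  "kext K t =
     (if t = 0 then Lim (at 0) (\<lambda>s. ereal (K s))
      else if t = -1 then Lim (at_right (-1)) (\<lambda>s. ereal (K s))
      else if t = 1 then Lim (at_left 1) (\<lambda>s. ereal (K s))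
      else ereal (K t))"

definition singular_kernel :: "(real \<Rightarrow> real) \<Rightarrow> bool" where
  "singular_kernel K \<longleftrightarrow> kernel_function K \<and> kext K 0 = -\<infinity>"

definition PM :: "real \<Rightarrow> (real \<Rightarrow> real) \<Rightarrow> bool" where
  "PM c K \<longleftrightarrow> (AE t in lborel. t \<in> {0<..<1} \<longrightarrow> deriv K t - deriv K (t - 1) \<ge> c)"

definition weight :: "real set \<Rightarrow> ereal" where
  "weight A = (if finite A then ereal (\<Sum>t\<in>A. if t = 0 \<or> t = 1 then 1/2 else 1) else \<infinity>)"

definition field_function :: "nat \<Rightarrow> (real \<Rightarrow> ereal) \<Rightarrow> bool" where
  "field_function n J \<longleftrightarrow>
     (\<forall>t\<in>{0..1}. J t \<noteq> \<infinity>) \<and>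
     (\<exists>M. \<forall>t\<in>{0..1}. J t \<le> ereal M) \<and>
     weight {t\<in>{0..1}. J t \<noteq> -\<infinity>} > ereal (real n)"

text \<open>Points y of R^n are vectors indexed by a finite linearly ordered type 'n
  (so n = CARD('n) and the coordinates y_1 < ... < y_n are listed in the order of 'n).\<close>

definition simplexS :: "((real, 'n::{finite,linorder}) vec) set" where
  "simplexS = {y. (\<forall>i. 0 < y$i \<and> y$i < 1) \<and> (\<forall>i j. i < j \<longrightarrow> y$i < y$j)}"

definition Ffun :: "(real \<Rightarrow> ereal) \<Rightarrow> (('n::{finite,linorder}) \<Rightarrow> real \<Rightarrow> real)
                     \<Rightarrow> (real, 'n) vec \<Rightarrow> real \<Rightarrow> ereal" where
  "Ffun J K y t = J t + (\<Sum>j\<in>UNIV. kext (K j) (t - y$j))"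

definition next_pt :: "(real, 'n::{finite,linorder}) vec \<Rightarrow> 'n \<Rightarrow> real" where
  "next_pt y i = (if \<exists>j. i < j then y $ (LEAST j. i < j) else 1)"

definition prev_pt :: "(real, 'n::{finite,linorder}) vec \<Rightarrow> 'n \<Rightarrow> real" where
  "prev_pt y i = (if \<exists>j. j < i then y $ (GREATEST j. j < i) else 0)"

text \<open>For the coordinate index i (= j-th index, 1<=j<=n):
  m_after i = m_j = sup of F over [y_j, y_{j+1}],  m_before i = m_{j-1} = sup over [y_{j-1}, y_j].\<close>
definition m_after :: "(real \<Rightarrow> ereal) \<Rightarrow> (('n::{finite,linorder}) \<Rightarrow> real \<Rightarrow> real)
                        \<Rightarrow> (real, 'n) vec \<Rightarrow> 'n \<Rightarrow> ereal" where
  "m_after J K y i = Sup (Ffun J K y ` {y$i .. next_pt y i})"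

definition m_before :: "(real \<Rightarrow> ereal) \<Rightarrow> (('n::{finite,linorder}) \<Rightarrow> real \<Rightarrow> real)
                        \<Rightarrow> (real, 'n) vec \<Rightarrow> 'n \<Rightarrow> ereal" where
  "m_before J K y i = Sup (Ffun J K y ` {prev_pt y i .. y$i})"

definition regY :: "(real \<Rightarrow> ereal) \<Rightarrow> (('n::{finite,linorder}) \<Rightarrow> real \<Rightarrow> real)
                     \<Rightarrow> ((real, 'n) vec) set" where
  "regY J K = {y \<in> simplexS. \<forall>i. m_after J K y i \<noteq> -\<infinity> \<and> m_before J K y i \<noteq> -\<infinity>}"

definition Phi :: "(real \<Rightarrow> ereal) \<Rightarrow> (('n::{finite,linorder}) \<Rightarrow> real \<Rightarrow> real)
                     \<Rightarrow> (real, 'n) vec \<Rightarrow> (real, 'n) vec" where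
  "Phi J K y = (\<chi> i. real_of_ereal (m_after J K y i - m_before J K y i))"

definition locally_bilipschitz_on :: "('a::metric_space) set \<Rightarrow> ('a \<Rightarrow> 'b::metric_space) \<Rightarrow> bool" where
  "locally_bilipschitz_on A f \<longleftrightarrow>
     (\<forall>x\<in>A. \<exists>e>0. \<exists>L. \<forall>a\<in>A \<inter> ball x e. \<forall>b\<in>A \<inter> ball x e.
        dist (f a) (f b) \<le> L * dist a b \<and> dist a b \<le> L * dist (f a) (f b))"

end

theory Submission
  imports Defs
begin

text \<open>
  In the smooth case \<open>\<partial>\<Phi>\<^sub>j/\<partial>y\<^sub>i = K\<^sub>i'(z\<^sub>j\<^sub>-\<^sub>1 - y\<^sub>i) - K\<^sub>i'(z\<^sub>j - y\<^sub>i)\<close>, where \<open>z\<^sub>j\<close> is a maximum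
  point on \<open>I\<^sub>j\<close>. By concavity this is nonnegative for \<open>i \<noteq> j\<close>, and by (PM) all column sums are at
  most \<open>-c\<close>; so the Jacobian expands the \<open>\<ell>\<^sup>1\<close>-norm by a factor of at least \<open>c\<close>. A discrete form
  of this argument gives \<open>c \<parallel>x - y\<parallel>\<^sub>1 \<le> \<parallel>\<Phi>(x) - \<Phi>(y)\<parallel>\<^sub>1\<close> for all \<open>x, y \<in> Y\<close>, without any
  smoothness or convexity of \<open>Y\<close>. Since kernels are singular, the suprema are determined away from
  the nodes, whence \<open>Y\<close> is open and \<open>\<Phi>\<close> is locally Lipschitz. By invariance of domain \<open>\<Phi>(Y)\<close> is
  open; by the expansion estimate it is also closed, hence it is the whole space.
\<close>

section \<open>Concave functions on an open interval\<close>

text \<open>Integrating a Jacobian along the segment from \<open>x\<close> to \<open>y\<close> is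
  impossible: the segment may leave \<open>Y\<close>, kernels may have corners, and suprema over an
  arbitrary \<open>J\<close> need not be attained. What survives for each \<open>K i\<close>, say
  with \<open>x $ i < y $ i\<close>, is the behaviour of
  \<open>z \<mapsto> K i (z - y $ i) - K i (z - x $ i)\<close>: it increases on either side of the
  gap between the two coordinates, and by (PM) its values to the right of the gap are smaller by at
  least \<open>c * (y $ i - x $ i)\<close> than those to the left. Points inside the gap are
  uncontrolled; therefore suprema are compared only at points that lie in the interval of the same
  index for both \<open>x\<close> and \<open>y\<close>.

  The weight bound enters twice. It yields \<open>N + 1\<close> points of finite field, hence an
  element of \<open>Y\<close>. In the closedness argument nodes may tend to 0 or 1 while kernels may
  tend to -infinity at -1 and 1; so a finite limit value needs a point off the nodes and at distance
  less than 1 from all of them. The weight 1/2 of the endpoints is what provides it.\<close>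

lemma concave_on_supergradient:
  fixes f :: "real \<Rightarrow> real"
  assumes "concave_on {a<..<b} f"
  obtains d where "\<And>x y. x \<in> {a<..<b} \<Longrightarrow> y \<in> {a<..<b} \<Longrightarrow> f y \<le> f x + d x * (y - x)"
    and "\<And>x y. x \<in> {a<..<b} \<Longrightarrow> y \<in> {a<..<b} \<Longrightarrow> x \<le> y \<Longrightarrow> d y \<le> d x"
proof -
  let ?I = "{a<..<b}"
  have cv: "convex_on ?I (\<lambda>x. - f x)"
    using assms by (simp add: concave_on_def)
  \<comment> \<open>This is the right derivative of \<open>f\<close>: the slopes of the convex
    function \<open>- f\<close> decrease as \<open>t\<close> approaches \<open>x\<close> from above,
    so their infimum is its right derivative.\<close>
  define d where "d x = - Inf ((\<lambda>t. (- f x - (- f t)) / (x - t)) ` ({x<..} \<inter> ?I))" for x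
  have 1: "f y \<le> f x + d x * (y - x)" if "x \<in> ?I" "y \<in> ?I" for x y
    using convex_le_Inf_differential[OF cv, of x y] that
    by (simp add: d_def interior_open algebra_simps)
  have 2: "d y \<le> d x" if "x \<in> ?I" "y \<in> ?I" "x \<le> y" for x y
  proof (cases "x = y")
    case False
    with that have "x < y" by simp
    have "(d y - d x) * (y - x) \<le> 0"
      using 1[OF that(1,2)] 1[OF that(2,1)] by (simp add: algebra_simps)
    with \<open>x < y\<close> show ?thesis
      by (simp add: mult_le_0_iff)
  qed simp
  show ?thesis using that 1 2 by blast
qed

text \<open>Both \<open>v\<close> and \<open>u + h\<close> are convex combinations of
  \<open>u\<close> and \<open>v + h\<close>, with the weights \<open>t\<close> and
  \<open>1 - t\<close> exchanged, so the weights cancel when the two concavity inequalities are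
  added. The order of \<open>v\<close> and \<open>u + h\<close> is irrelevant.\<close>

lemma concave_on_increment_antimono:
  fixes f :: "real \<Rightarrow> real"
  assumes f: "concave_on I f" and "u \<in> I" "v + h \<in> I" "u \<le> v" "0 \<le> h"
  shows "f (v + h) - f v \<le> f (u + h) - f u"
proof (cases "v + h = u")
  case True
  with assms have "v = u" "h = 0" by auto
  then show ?thesis by simp
next
  case False
  define t where "t = (v - u) / (v + h - u)"
  have pos: "v + h - u > 0" using False assms by linarith
  then have t: "0 \<le> t" "t \<le> 1" using assms by (auto simp: t_def)
  have tt: "t * (v + h - u) = v - u" using pos by (simp add: t_def)
  have e1: "(1 - t) *\<^sub>R u + t *\<^sub>R (v + h) = v"
    using tt by (simp add: algebra_simps)
  have e2: "(1 - (1 - t)) *\<^sub>R u + (1 - t) *\<^sub>R (v + h) = u + h"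
    using tt by (simp add: algebra_simps)
  have "(1 - t) * f u + t * f (v + h) \<le> f v"
    using concave_onD[OF f t assms(2,3)] e1 by simp
  moreover have "(1 - (1 - t)) * f u + (1 - t) * f (v + h) \<le> f (u + h)"
    using concave_onD[OF f, of "1 - t" u "v + h"] t assms(2,3) unfolding e2 by simp
  ultimately show ?thesis by (simp add: algebra_simps)
qed

lemma concave_on_bounded_above:
  fixes f :: "real \<Rightarrow> real"
  assumes "concave_on {a<..<b} f"
  obtains C where "\<And>t. t \<in> {a<..<b} \<Longrightarrow> f t \<le> C"
proof (cases "a < b")
  case True
  obtain d where d: "\<And>x y. x \<in> {a<..<b} \<Longrightarrow> y \<in> {a<..<b} \<Longrightarrow> f y \<le> f x + d x * (y - x)"
    using concave_on_supergradient[OF assms] by metis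
  let ?m = "(a + b) / 2"
  have "f t \<le> f ?m + \<bar>d ?m\<bar> * (b - a)" if "t \<in> {a<..<b}" for t
  proof -
    have "d ?m * (t - ?m) \<le> \<bar>d ?m\<bar> * \<bar>t - ?m\<bar>"
      by (metis abs_ge_self abs_mult)
    also have "\<dots> \<le> \<bar>d ?m\<bar> * (b - a)"
      using that by (intro mult_left_mono) (auto simp: abs_if field_simps)
    finally show ?thesis using d[of ?m t] that True by auto
  qed
  then show ?thesis using that by blast
qed (use that in auto)

lemma concave_on_lipschitz_compact:
  fixes f :: "real \<Rightarrow> real"
  assumes f: "concave_on {a<..<b} f" and "a < u" "v < b"
  obtains L where "0 \<le> L" "\<And>x y. x \<in> {u..v} \<Longrightarrow> y \<in> {u..v} \<Longrightarrow> \<bar>f x - f y\<bar> \<le> L * \<bar>x - y\<bar>"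
proof -
  obtain d where d: "\<And>x y. x \<in> {a<..<b} \<Longrightarrow> y \<in> {a<..<b} \<Longrightarrow> f y \<le> f x + d x * (y - x)"
    and mono: "\<And>x y. x \<in> {a<..<b} \<Longrightarrow> y \<in> {a<..<b} \<Longrightarrow> x \<le> y \<Longrightarrow> d y \<le> d x"
    using concave_on_supergradient[OF f] by metis
  define L where "L = max \<bar>d u\<bar> \<bar>d v\<bar>"
  have dL: "\<bar>d x\<bar> \<le> L" if "x \<in> {u..v}" for x
    using mono[of u x] mono[of x v] that assms unfolding L_def by auto
  have one: "f y - f x \<le> L * \<bar>x - y\<bar>" if "x \<in> {u..v}" "y \<in> {u..v}" for x y
  proof -
    have "f y - f x \<le> d x * (y - x)" using d[of x y] that assms by auto
    also have "\<dots> \<le> \<bar>d x\<bar> * \<bar>y - x\<bar>" by (metis abs_ge_self abs_mult)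
    also have "\<dots> \<le> L * \<bar>y - x\<bar>" using dL[OF that(1)] by (intro mult_right_mono) auto
    finally show ?thesis by (simp add: abs_minus_commute)
  qed
  have "\<bar>f x - f y\<bar> \<le> L * \<bar>x - y\<bar>" if "x \<in> {u..v}" "y \<in> {u..v}" for x y
    using one[OF that] one[OF that(2,1)] by (simp add: abs_le_iff abs_minus_commute)
  moreover have "0 \<le> L" by (simp add: L_def)
  ultimately show ?thesis using that by blast
qed

lemma concave_on_continuous_on:
  fixes f :: "real \<Rightarrow> real"
  assumes "concave_on {a<..<b} f"
  shows "continuous_on {a<..<b} f"
  using continuous_on_minus[OF convex_on_continuous[of "{a<..<b}" "\<lambda>x. - f x"]] assms
  by (simp add: concave_on_def)

text \<open>The monotone slope function \<open>d\<close> has only countably many discontinuities.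
  The difference quotient between \<open>x\<close> and \<open>y\<close> lies between
  \<open>d x\<close> and \<open>d y\<close>, hence converges wherever \<open>d\<close> is
  continuous.\<close>

lemma concave_on_countable_nondifferentiable:
  fixes f :: "real \<Rightarrow> real"
  assumes f: "concave_on {a<..<b} f"
  shows "countable {x\<in>{a<..<b}. \<not> f field_differentiable at x}"
proof -
  obtain d where d: "\<And>x y. x \<in> {a<..<b} \<Longrightarrow> y \<in> {a<..<b} \<Longrightarrow> f y \<le> f x + d x * (y - x)"
    and mono: "\<And>x y. x \<in> {a<..<b} \<Longrightarrow> y \<in> {a<..<b} \<Longrightarrow> x \<le> y \<Longrightarrow> d y \<le> d x"
    using concave_on_supergradient[OF f] by metis
  have "countable {x\<in>{a<..<b}. \<not> isCont (\<lambda>x. - d x) x}"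
    by (intro mono_on_ctble_discont_open mono_onI) (use mono in auto)
  moreover have "f field_differentiable at x" if x: "x \<in> {a<..<b}" and c: "isCont (\<lambda>x. - d x) x" for x
  proof -
    have dc: "(d \<longlongrightarrow> d x) (at x)"
      using isCont_minus[OF c] by (simp add: isCont_def)
    have "((\<lambda>y. (f y - f x) / (y - x) - d x) \<longlongrightarrow> 0) (at x)"
    proof (rule Lim_null_comparison)
      show "((\<lambda>y. \<bar>d y - d x\<bar>) \<longlongrightarrow> 0) (at x)"
        by (intro tendsto_rabs_zero LIM_zero dc)
      have "\<forall>\<^sub>F y in at x. y \<in> {a<..<b}"
        using x by (intro eventually_at_in_open') auto
      moreover have "\<forall>\<^sub>F y in at x. y \<noteq> x"
        by (simp add: eventually_at_filter)
      ultimately show "\<forall>\<^sub>F y in at x. norm ((f y - f x) / (y - x) - d x) \<le> \<bar>d y - d x\<bar>"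
      proof eventually_elim
        case (elim y)
        have 1: "f y \<le> f x + d x * (y - x)" "f x \<le> f y + d y * (x - y)"
          using d elim x by auto
        show ?case
        proof (cases "y > x")
          case True
          with 1 have "(f y - f x) / (y - x) \<le> d x" "d y \<le> (f y - f x) / (y - x)"
            by (auto simp: field_simps)
          then show ?thesis by simp
        next
          case False
          with elim have "y < x" by simp
          with 1 have "d x \<le> (f y - f x) / (y - x)" "(f y - f x) / (y - x) \<le> d y"
            by (auto simp: field_simps)
          then show ?thesis by simp
        qed
      qed
    qed
    then have "((\<lambda>y. (f y - f x) / (y - x)) \<longlongrightarrow> d x) (at x)"
      by (rule LIM_zero_cancel)
    then show ?thesis
      by (auto simp: field_differentiable_def has_field_derivative_iff)
  qed
  ultimately show ?thesis
    by (elim countable_subset[rotated]) auto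
qed

text \<open>Monotonicity near \<open>a\<close> suffices in the extended reals. If some slope is
  positive, then so are all slopes to its left and \<open>f\<close> increases there; otherwise
  \<open>f\<close> decreases on the whole interval.\<close>

lemma concave_on_ereal_limit_at_right:
  fixes f :: "real \<Rightarrow> real"
  assumes f: "concave_on {a<..<b} f" and "a < b"
  obtains l where "((\<lambda>t. ereal (f t)) \<longlongrightarrow> l) (at_right a)"
proof -
  obtain d where d: "\<And>x y. x \<in> {a<..<b} \<Longrightarrow> y \<in> {a<..<b} \<Longrightarrow> f y \<le> f x + d x * (y - x)"
    and mono: "\<And>x y. x \<in> {a<..<b} \<Longrightarrow> y \<in> {a<..<b} \<Longrightarrow> x \<le> y \<Longrightarrow> d y \<le> d x"
    using concave_on_supergradient[OF f] by metis
  show ?thesis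
  proof (cases "\<exists>x\<in>{a<..<b}. 0 < d x")
    case True
    then obtain x where x: "x \<in> {a<..<b}" "0 < d x" by blast
    have "f u \<le> f v" if "u \<in> {a<..<x}" "v \<in> {a<..<x}" "a < u" "u \<le> v" for u v
    proof -
      have "f u \<le> f v + d v * (u - v)" using d x that by auto
      moreover have "0 < d v" using mono[of v x] x that by auto
      then have "d v * (u - v) \<le> 0" using that by (simp add: mult_le_0_iff)
      ultimately show ?thesis by linarith
    qed
    then have "((\<lambda>t. ereal (f t)) \<longlongrightarrow> Inf ((\<lambda>t. ereal (f t)) ` ({a<..} \<inter> {a<..<x})))
        (at a within ({a<..} \<inter> {a<..<x}))"
      by (intro Lim_right_bound[where K = "-\<infinity>"]) auto
    moreover have "at a within ({a<..} \<inter> {a<..<x}) = at_right a"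
      using x by (intro at_within_nhd[where S = "{..<x}"]) auto
    ultimately show ?thesis using that by metis
  next
    case False
    have "f v \<le> f u" if "u \<in> {a<..<b}" "v \<in> {a<..<b}" "a < u" "u \<le> v" for u v
    proof -
      have "f v \<le> f u + d u * (v - u)" using d that by auto
      moreover have "d u \<le> 0" using False that by force
      then have "d u * (v - u) \<le> 0" using that by (simp add: mult_le_0_iff)
      ultimately show ?thesis by linarith
    qed
    then have "((\<lambda>t. - ereal (f t)) \<longlongrightarrow> Inf ((\<lambda>t. - ereal (f t)) ` ({a<..} \<inter> {a<..<b})))
        (at a within ({a<..} \<inter> {a<..<b}))"
      by (intro Lim_right_bound[where K = "-\<infinity>"]) auto
    moreover have "at a within ({a<..} \<inter> {a<..<b}) = at_right a"
      using \<open>a < b\<close> by (intro at_within_nhd[where S = "{..<b}"]) auto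
    ultimately have "((\<lambda>t. - (- ereal (f t))) \<longlongrightarrow> - Inf ((\<lambda>t. - ereal (f t)) ` ({a<..} \<inter> {a<..<b})))
        (at_right a)"
      using tendsto_uminus_ereal by metis
    then show ?thesis using that by simp
  qed
qed

lemma concave_on_reflect:
  fixes f :: "real \<Rightarrow> real"
  assumes "concave_on {a<..<b} f"
  shows "concave_on {-b<..<-a} (\<lambda>t. f (- t))"
  unfolding concave_on_iff
proof (intro conjI ballI allI impI)
  fix x y u v :: real
  assume *: "x \<in> {-b<..<-a}" "y \<in> {-b<..<-a}" "0 \<le> u" "0 \<le> v" "u + v = 1"
  then have "-x \<in> {a<..<b}" "-y \<in> {a<..<b}" by auto
  then have "u * f (- x) + v * f (- y) \<le> f (u *\<^sub>R (- x) + v *\<^sub>R (- y))"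
    using assms * unfolding concave_on_iff by blast
  then show "u * f (- x) + v * f (- y) \<le> f (- (u *\<^sub>R x + v *\<^sub>R y))"
    by simp
qed simp

lemma concave_on_ereal_limit_at_left:
  fixes f :: "real \<Rightarrow> real"
  assumes f: "concave_on {a<..<b} f" and "a < b"
  obtains l where "((\<lambda>t. ereal (f t)) \<longlongrightarrow> l) (at_left b)"
proof -
  obtain l where "((\<lambda>t. ereal (f (- t))) \<longlongrightarrow> l) (at_right (- b))"
    using concave_on_ereal_limit_at_right[OF concave_on_reflect[OF f]] \<open>a < b\<close> by auto
  then have "((\<lambda>t. ereal (f t)) \<longlongrightarrow> l) (at_left b)"
    by (simp add: filterlim_at_left_to_right)
  then show ?thesis by (rule that)
qed

section \<open>Kernels\<close>

text \<open>\<open>Lim\<close> carries information only once a limit is known to exist. Concavity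
  gives the one-sided limits; since they agree, they form a two-sided limit, whose value is then the
  prescribed one.\<close>

lemma singular_kernel_at_bot:
  assumes "singular_kernel K"
  shows "filterlim K at_bot (at 0)"
proof -
  have c: "concave_on {-1<..<0} K" "concave_on {0<..<1} K"
    and eq: "Lim (at_right 0) (\<lambda>t. ereal (K t)) = Lim (at_left 0) (\<lambda>t. ereal (K t))"
    and s: "Lim (at 0) (\<lambda>t. ereal (K t)) = -\<infinity>"
    using assms by (auto simp: singular_kernel_def kernel_function_def kext_def)
  obtain l where l: "((\<lambda>t. ereal (K t)) \<longlongrightarrow> l) (at_left 0)"
    using concave_on_ereal_limit_at_left[OF c(1)] by auto
  obtain r where r: "((\<lambda>t. ereal (K t)) \<longlongrightarrow> r) (at_right 0)"
    using concave_on_ereal_limit_at_right[OF c(2)] by auto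
  have "l = r"
    using eq tendsto_Lim[OF _ l] tendsto_Lim[OF _ r] by simp
  then have "((\<lambda>t. ereal (K t)) \<longlongrightarrow> r) (at 0)"
    using l r by (simp add: filterlim_split_at)
  moreover from this have "r = -\<infinity>"
    using s tendsto_Lim[of "at 0" "\<lambda>t. ereal (K t)" r] by simp
  ultimately show ?thesis
    by (simp add: tendsto_MInfty filterlim_at_bot_dense)
qed

lemma deriv_supergradient:
  fixes f :: "real \<Rightarrow> real"
  assumes f: "concave_on {a<..<b} f" and x: "x \<in> {a<..<b}" and y: "y \<in> {a<..<b}"
    and diff: "f field_differentiable at x"
  shows "f y \<le> f x + deriv f x * (y - x)"
proof -
  have "(- f y) - (- f x) \<ge> (- deriv f x) * (y - x)"
  proof (rule convex_on_imp_above_tangent)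
    show "convex_on {a<..<b} (\<lambda>x. - f x)"
      using f by (simp add: concave_on_def)
    have "(f has_field_derivative deriv f x) (at x within {a<..<b})"
      using diff DERIV_deriv_iff_field_differentiable has_field_derivative_at_within by blast
    then show "((\<lambda>x. - f x) has_real_derivative - deriv f x) (at x within {a<..<b})"
      by (rule DERIV_minus)
  qed (use x y in \<open>auto simp: interior_open\<close>)
  then show ?thesis by (simp add: algebra_simps)
qed

text \<open>A set of full measure meets every nondegenerate interval, even after removal of a
  countable set. This supplies points arbitrarily close to a given one at which the condition on
  derivatives can be used.\<close>

lemma AE_interval_point:
  fixes P :: "real \<Rightarrow> bool"
  assumes "AE t in lborel. P t" and "countable C" and "u < v"
  obtains t where "u < t" "t < v" "P t" "t \<notin> C"
proof -
  have "AE t in lborel. t \<notin> C"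
    using countable_imp_null_set_lborel[OF assms(2)] by (rule AE_not_in)
  with assms(1) have ae: "AE t in lborel. P t \<and> t \<notin> C"
    by (rule AE_conjI)
  show ?thesis
  proof (rule ccontr)
    assume "\<not> thesis"
    then have "\<not> (u < t \<and> t < v)" if "P t \<and> t \<notin> C" for t
      using that \<open>\<And>t. u < t \<Longrightarrow> t < v \<Longrightarrow> P t \<Longrightarrow> t \<notin> C \<Longrightarrow> thesis\<close> by blast
    then have "AE t in lborel. t \<notin> {u<..<v}"
      using ae by (elim eventually_mono) auto
    then have "emeasure lborel {u<..<v} = 0"
      by (subst (asm) AE_iff_measurable[of "{u<..<v}"]) auto
    then show False using \<open>u < v\<close> by simp
  qed
qed

text \<open>The almost everywhere condition on derivatives is turned into one on increments: it gives
  K(s) - K(s-h) \<ge> K(s-1+h) - K(s-1) + c h at almost every s, hence by continuity at every s,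
  and these inequalities telescope along s = a+h, a+2h, \<dots>, b with h tending to 0.\<close>
lemma PM_increment:
  assumes ker: "kernel_function K" and pm: "PM c K" and ab: "0 < a" "a \<le> b" "b < 1"
  shows "K (b - 1) - K (a - 1) + c * (b - a) \<le> K b - K a"
proof -
  have c: "concave_on {-1<..<0} K" "concave_on {0<..<1} K"
    using ker by (auto simp: kernel_function_def)
  have contL: "isCont K x" if "x \<in> {-1<..<0}" for x
    using concave_on_continuous_on[OF c(1)] that by (simp add: continuous_on_eq_continuous_at)
  have contR: "isCont K x" if "x \<in> {0<..<1}" for x
    using concave_on_continuous_on[OF c(2)] that by (simp add: continuous_on_eq_continuous_at)
  \<comment> \<open>At points where \<open>K\<close> is not differentiable the value of
    \<open>deriv\<close> is meaningless. A point \<open>s\<close> is therefore bad if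
    \<open>K\<close> fails to be differentiable at \<open>s\<close> or at
    \<open>s - 1\<close>.\<close>
  define C where "C = {x\<in>{0<..<1}. \<not> K field_differentiable at x} \<union>
      (\<lambda>x. x + 1) ` {x\<in>{-1<..<0}. \<not> K field_differentiable at x}"
  have cC: "countable C"
    unfolding C_def using concave_on_countable_nondifferentiable c by auto
  have good: "K (s - 1 + h) - K (s - 1) + c * h \<le> K s - K (s - h)"
    if "0 < h" "0 < s - h" "s + h < 1" "s \<notin> C"
      and p: "s \<in> {0<..<1} \<longrightarrow> deriv K s - deriv K (s - 1) \<ge> c" for s h
  proof -
    have s: "s \<in> {0<..<1}" "s - 1 \<in> {-1<..<0}" using that by auto
    have "s = (s - 1) + 1" by simp
    then have df: "K field_differentiable at s" "K field_differentiable at (s - 1)"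
      using \<open>s \<notin> C\<close> s unfolding C_def by blast+
    have "K (s - h) \<le> K s - deriv K s * h"
      using deriv_supergradient[OF c(2) s(1) _ df(1), of "s - h"] that s by simp
    moreover have "K (s - 1 + h) \<le> K (s - 1) + deriv K (s - 1) * h"
      using deriv_supergradient[OF c(1) s(2) _ df(2), of "s - 1 + h"] that s by simp
    moreover have "c * h \<le> (deriv K s - deriv K (s - 1)) * h"
      using p s \<open>0 < h\<close> by (intro mult_right_mono) auto
    ultimately show ?thesis by (simp add: algebra_simps)
  qed
  have every: "K (s - 1 + h) - K (s - 1) + c * h \<le> K s - K (s - h)"
    if sh: "0 < h" "0 < s - h" "s + h < 1" for s h
  proof -
    have "\<exists>t. s < t \<and> t < s + 1 / Suc k \<and> t + h < 1 \<and>
        (t \<in> {0<..<1} \<longrightarrow> deriv K t - deriv K (t - 1) \<ge> c) \<and> t \<notin> C" for k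
    proof -
      have "s < min (s + 1 / Suc k) (1 - h)" using sh by simp
      from AE_interval_point[OF pm[unfolded PM_def] cC this] show ?thesis
        by (metis less_diff_eq min_less_iff_conj)
    qed
    then obtain t where t: "\<And>k. s < t k" "\<And>k. t k < s + 1 / Suc k" "\<And>k. t k + h < 1"
        "\<And>k. t k \<in> {0<..<1} \<longrightarrow> deriv K (t k) - deriv K (t k - 1) \<ge> c" "\<And>k. t k \<notin> C"
      by metis
    have "(\<lambda>k. s + 1 / Suc k) \<longlonglongrightarrow> s + 0"
      by (intro tendsto_intros LIMSEQ_Suc[OF lim_1_over_n])
    then have ts: "t \<longlonglongrightarrow> s"
      using t(1,2) by (intro tendsto_sandwich[of "\<lambda>_. s" t sequentially "\<lambda>k. s + 1 / Suc k"])
        (auto intro: always_eventually less_imp_le)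
    show ?thesis
    proof (rule LIMSEQ_le)
      show "(\<lambda>k. K (t k - 1 + h) - K (t k - 1) + c * h) \<longlonglongrightarrow> K (s - 1 + h) - K (s - 1) + c * h"
        by (intro tendsto_intros isCont_tendsto_compose[OF contL] ts) (use sh in auto)
      show "(\<lambda>k. K (t k) - K (t k - h)) \<longlonglongrightarrow> K s - K (s - h)"
        by (intro tendsto_intros isCont_tendsto_compose[OF contR] ts) (use sh in auto)
      have "K (t k - 1 + h) - K (t k - 1) + c * h \<le> K (t k) - K (t k - h)" for k
        using t(1)[of k] sh by (intro good t) auto
      then show "\<exists>N. \<forall>k\<ge>N. K (t k - 1 + h) - K (t k - 1) + c * h \<le> K (t k) - K (t k - h)"
        by blast
    qed
  qed
  show ?thesis
  proof (cases "a = b")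
    case False
    with ab have "a < b" by simp
    \<comment> \<open>The left side is displaced by one step \<open>h\<close>, because
      \<open>every\<close> compares a backward increment at \<open>s\<close> with a forward
      increment at \<open>s - 1\<close>. The displacement vanishes in the limit.\<close>
    have tele: "K (a + m * h + h - 1) - K (a + h - 1) + c * (m * h) \<le> K (a + m * h) - K a"
      if "0 < h" "a + m * h + h < 1" for m :: nat and h :: real
      using that(2)
    proof (induction m)
      case (Suc m)
      have "K (a + m * h + h - 1) - K (a + h - 1) + c * (m * h) \<le> K (a + m * h) - K a"
        using Suc.prems that(1) by (intro Suc.IH) (simp add: algebra_simps)
      moreover have "K (a + m * h + h - 1 + h) - K (a + m * h + h - 1) + c * h
          \<le> K (a + m * h + h) - K (a + m * h + h - h)"
        using Suc.prems that(1) ab(1) by (intro every) (auto simp: algebra_simps add_pos_nonneg)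
      ultimately show ?case by (simp add: algebra_simps)
    qed simp
    define h where "h k = (b - a) / Suc k" for k
    have "(\<lambda>k. (b - a) * (1 / Suc k)) \<longlonglongrightarrow> (b - a) * 0"
      by (intro tendsto_intros LIMSEQ_Suc[OF lim_1_over_n])
    then have h0: "h \<longlonglongrightarrow> 0" by (simp add: h_def[abs_def])
    have hpos: "0 < h k" for k using \<open>a < b\<close> by (simp add: h_def)
    have hm: "Suc k * h k = b - a" for k by (simp add: h_def)
    have "K (b - 1 + 0) - K (a - 1 + 0) + c * (b - a) \<le> K b - K a"
    proof (rule LIMSEQ_le_const2)
      show "(\<lambda>k. K (b - 1 + h k) - K (a - 1 + h k) + c * (b - a))
          \<longlonglongrightarrow> K (b - 1 + 0) - K (a - 1 + 0) + c * (b - a)"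
        by (intro tendsto_intros isCont_tendsto_compose[OF contL] h0) (use ab in auto)
      have "\<forall>\<^sub>F k in sequentially. h k < 1 - b"
        using order_tendstoD(2)[OF h0] ab by simp
      then obtain N where N: "\<And>k. k \<ge> N \<Longrightarrow> h k < 1 - b"
        by (auto simp: eventually_sequentially)
      have "K (b - 1 + h k) - K (a - 1 + h k) + c * (b - a) \<le> K b - K a" if "k \<ge> N" for k
        \<comment> \<open>With \<open>Suc k\<close> steps of length \<open>h k\<close> the last
          point is \<open>b\<close>, and \<open>h k < 1 - b\<close> keeps the additional forward
          step inside the domain.\<close>
        using tele[OF hpos, where m = "Suc k", of k] N[OF that]
        unfolding hm by (simp add: algebra_simps)
      then show "\<exists>N. \<forall>k\<ge>N. K (b - 1 + h k) - K (a - 1 + h k) + c * (b - a) \<le> K b - K a"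
        by blast
    qed
    then show ?thesis by simp
  qed simp
qed

text \<open>To the left of \<open>x\<close> both arguments are negative, to the right of
  \<open>y\<close> both are positive, so monotonicity is concavity of one branch. The jump uses
  periodicity: since \<open>z \<le> w + 1\<close>, concavity compares \<open>z\<close> with
  \<open>w + 1\<close> on the positive branch, and \<open>PM_increment\<close> leads from
  \<open>w + 1\<close> back to \<open>w\<close>.\<close>

lemma kernel_shift:
  assumes ker: "kernel_function K" and pm: "PM c K" and xy: "0 < x" "x < y" "y < 1"
  defines "g \<equiv> \<lambda>z. K (z - y) - K (z - x)"
  shows "0 \<le> z \<Longrightarrow> z \<le> z' \<Longrightarrow> z' < x \<Longrightarrow> g z \<le> g z'"
    and "y < z \<Longrightarrow> z \<le> z' \<Longrightarrow> z' \<le> 1 \<Longrightarrow> g z \<le> g z'"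
    and "0 \<le> w \<Longrightarrow> w < x \<Longrightarrow> y < z \<Longrightarrow> z \<le> 1 \<Longrightarrow> g z + c * (y - x) \<le> g w"
proof -
  have cc: "concave_on {-1<..<0} K" "concave_on {0<..<1} K"
    using ker by (auto simp: kernel_function_def)
  show "0 \<le> z \<Longrightarrow> z \<le> z' \<Longrightarrow> z' < x \<Longrightarrow> g z \<le> g z'"
    using concave_on_increment_antimono[OF cc(1), of "z - y" "z' - y" "y - x"] xy
    by (simp add: g_def)
  show "y < z \<Longrightarrow> z \<le> z' \<Longrightarrow> z' \<le> 1 \<Longrightarrow> g z \<le> g z'"
    using concave_on_increment_antimono[OF cc(2), of "z - y" "z' - y" "y - x"] xy
    by (simp add: g_def)
  assume *: "0 \<le> w" "w < x" "y < z" "z \<le> 1"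
  have "K (w + 1 - x) - K (w + 1 - y) \<le> K (z - x) - K (z - y)"
    using concave_on_increment_antimono[OF cc(2), of "z - y" "w + 1 - y" "y - x"] xy *
    by (simp add: add_diff_eq)
  moreover have "K (w - x) - K (w - y) + c * (y - x) \<le> K (w + 1 - x) - K (w + 1 - y)"
    using PM_increment[OF ker pm, of "w + 1 - y" "w + 1 - x"] xy * by simp
  ultimately show "g z + c * (y - x) \<le> g w" by (simp add: g_def)
qed

section \<open>Summation by parts with a bounded sign sequence\<close>

lemma sum_by_parts:
  fixes s d :: "nat \<Rightarrow> real"
  shows "(\<Sum>p=1..k. s p * (d p - d (p - 1)))
    = (\<Sum>j\<le>k. (s j - s (Suc j)) * d j) + s (Suc k) * d k - s 0 * d 0"
  by (induction k) (simp_all add: algebra_simps)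

text \<open>The terms with \<open>s j = s (Suc j)\<close> vanish, so nothing is required of \<open>g\<close> there. The bound
  \<open>B\<close> is variable in the induction: it is replaced by the most recent relevant value of \<open>g\<close>.\<close>
lemma monotone_sum_by_parts_le:
  fixes s g :: "nat \<Rightarrow> real"
  assumes "a \<le> b" and s1: "\<And>j. a \<le> j \<Longrightarrow> j \<le> b \<Longrightarrow> s j \<le> 1"
    and "\<And>j k. a \<le> j \<Longrightarrow> j \<le> k \<Longrightarrow> k < b \<Longrightarrow> s j \<noteq> s (Suc j) \<Longrightarrow> s k \<noteq> s (Suc k) \<Longrightarrow> g j \<le> g k"
    and "\<And>j. a \<le> j \<Longrightarrow> j < b \<Longrightarrow> s j \<noteq> s (Suc j) \<Longrightarrow> G \<le> g j"
    and "\<And>j. a \<le> j \<Longrightarrow> j < b \<Longrightarrow> s j \<noteq> s (Suc j) \<Longrightarrow> g j \<le> B"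
    and "G \<le> B"
  shows "(\<Sum>j=a..<b. (s j - s (Suc j)) * g j) \<le> (1 - s b) * B - (1 - s a) * G"
  using assms
proof (induction b arbitrary: B rule: dec_induct)
  case base
  then have "0 \<le> (1 - s a) * (B - G)" by (intro mult_nonneg_nonneg) auto
  then show ?case by (simp add: algebra_simps)
next
  case (step b)
  show ?case
  proof (cases "s b = s (Suc b)")
    case True
    have "(\<Sum>j=a..<b. (s j - s (Suc j)) * g j) \<le> (1 - s b) * B - (1 - s a) * G"
      using step.prems by (intro step.IH) (simp_all add: less_Suc_eq)
    with True step.hyps show ?thesis by simp
  next
    case False
    have "(\<Sum>j=a..<b. (s j - s (Suc j)) * g j) \<le> (1 - s b) * g b - (1 - s a) * G"
      using step.prems step.hyps False by (intro step.IH) (simp_all add: less_Suc_eq)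
    then have "(\<Sum>j=a..<Suc b. (s j - s (Suc j)) * g j) \<le> (1 - s (Suc b)) * g b - (1 - s a) * G"
      using step.hyps by (simp add: algebra_simps)
    also have "(1 - s (Suc b)) * g b \<le> (1 - s (Suc b)) * B"
      using step.prems(1)[of "Suc b"] step.prems(4)[of b] step.hyps False
      by (intro mult_left_mono) auto
    finally show ?thesis by simp
  qed
qed

lemma exists_consecutive_ne:
  assumes "a \<le> b" "s a \<noteq> s b"
  shows "\<exists>j\<in>{a..<b}. s j \<noteq> s (Suc j)"
proof (rule ccontr)
  assume "\<not> ?thesis"
  then have eq: "s j = s (Suc j)" if "a \<le> j" "j < b" for j
    using that by auto
  have "s k = s a" if "a \<le> k" "k \<le> b" for k
    using that by (induction k rule: dec_induct) (auto simp: eq[symmetric])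
  from this[OF assms(1) order.refl] show False using assms(2) by metis
qed

text \<open>The sum is split at \<open>p\<close>. Because \<open>s p = 1\<close>, the factor
  \<open>1 - s p\<close> removes the maximum from the left bound and the minimum from the right one;
  what remains is the right maximum minus the left minimum, which is the jump. Both extrema exist
  because \<open>s\<close> must change on either side of \<open>p\<close>.\<close>

lemma sum_by_parts_jump_le:
  fixes s g :: "nat \<Rightarrow> real"
  assumes s0: "s 0 = 0" and sN: "s (Suc N) = 0" and sp: "s p = 1" and pN: "p \<le> N"
    and s1: "\<And>j. s j \<le> 1"
    and left: "\<And>j k. j \<le> k \<Longrightarrow> k < p \<Longrightarrow> s j \<noteq> s (Suc j) \<Longrightarrow> s k \<noteq> s (Suc k) \<Longrightarrow> g j \<le> g k"
    and right: "\<And>j k. p \<le> j \<Longrightarrow> j \<le> k \<Longrightarrow> k \<le> N \<Longrightarrow> s j \<noteq> s (Suc j) \<Longrightarrow> s k \<noteq> s (Suc k) \<Longrightarrow> g j \<le> g k"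
    and jump: "\<And>j k. j < p \<Longrightarrow> p \<le> k \<Longrightarrow> k \<le> N \<Longrightarrow> s j \<noteq> s (Suc j) \<Longrightarrow> s k \<noteq> s (Suc k) \<Longrightarrow> g k + d \<le> g j"
  shows "(\<Sum>j\<le>N. (s j - s (Suc j)) * g j) \<le> - d"
proof -
  define L where "L = {j\<in>{0..<p}. s j \<noteq> s (Suc j)}"
  define R where "R = {j\<in>{p..<Suc N}. s j \<noteq> s (Suc j)}"
  have ne: "L \<noteq> {}" "R \<noteq> {}"
    using exists_consecutive_ne[of 0 p s] exists_consecutive_ne[of p "Suc N" s] s0 sN sp pN
    by (auto simp: L_def R_def)
  have fin: "finite (g ` L)" "finite (g ` R)" by (auto simp: L_def R_def)
  have mm: "Min (g ` X) \<le> Max (g ` X)" if "X \<noteq> {}" "finite (g ` X)" for X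
    using that by simp
  have "(\<Sum>j=0..<p. (s j - s (Suc j)) * g j) \<le> (1 - s p) * Max (g ` L) - (1 - s 0) * Min (g ` L)"
    by (rule monotone_sum_by_parts_le) (use s1 left fin ne mm in \<open>auto simp: L_def\<close>)
  moreover have "(\<Sum>j=p..<Suc N. (s j - s (Suc j)) * g j) \<le> (1 - s (Suc N)) * Max (g ` R) - (1 - s p) * Min (g ` R)"
    by (rule monotone_sum_by_parts_le) (use pN s1 right fin ne mm in \<open>auto simp: R_def\<close>)
  moreover have "Max (g ` R) + d \<le> Min (g ` L)"
  proof -
    obtain j k where "j \<in> L" "Min (g ` L) = g j" "k \<in> R" "Max (g ` R) = g k"
      using Min_in[OF fin(1)] Max_in[OF fin(2)] ne by auto
    then show ?thesis using jump[of j k] by (auto simp: L_def R_def)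
  qed
  moreover have "(\<Sum>j\<le>N. (s j - s (Suc j)) * g j)
      = (\<Sum>j=0..<p. (s j - s (Suc j)) * g j) + (\<Sum>j=p..<Suc N. (s j - s (Suc j)) * g j)"
    using sum.atLeastLessThan_concat[of 0 p "Suc N" "\<lambda>j. (s j - s (Suc j)) * g j"] pN
    by (metis atLeast0LessThan lessThan_Suc_atMost le0 le_SucI)
  ultimately show ?thesis using s0 sN sp by simp
qed

section \<open>Reduction to real-valued suprema\<close>

lemma finite_linorder_enumeration:
  fixes A :: "'a::linorder set"
  assumes "finite A"
  obtains h where "bij_betw h {..<card A} A" "\<And>i j. i < j \<Longrightarrow> j < card A \<Longrightarrow> h i < h j"
proof -
  let ?l = "sorted_list_of_set A"
  have "bij_betw ((!) ?l) {..<card A} A"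
    using bij_betw_nth[of ?l "{..<card A}" A] assms by simp
  moreover have "?l ! i < ?l ! j" if "i < j" "j < card A" for i j
    using sorted_wrt_nth_less[OF strict_sorted_list_of_set that(1)] that assms by simp
  ultimately show ?thesis using that by blast
qed

text \<open>The enumeration \<open>e\<close> lists the coordinates in increasing order, with indices from 1 as on
  paper. The set \<open>V y j\<close> consists of the points of the \<open>j\<close>-th interval at which \<open>F(y,\<cdot>)\<close> is
  finite; it is nonempty exactly if \<open>m\<^sub>j(y) \<noteq> -\<infinity>\<close>. The sign conditions defining it make
  sense for arbitrary \<open>y\<close> and imply that \<open>y\<close> lies in the simplex as soon as all \<open>V y j\<close> are
  nonempty.\<close>

locale translates =
  fixes K :: "'n::{finite,linorder} \<Rightarrow> real \<Rightarrow> real"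
    and J :: "real \<Rightarrow> ereal" and c :: real and N :: nat and e :: "nat \<Rightarrow> 'n"
  assumes c_pos: "0 < c"
    and singular: "\<And>i. singular_kernel (K i)"
    and pm: "\<And>i. PM c (K i)"
    and N_card: "N = CARD('n)"
    and field: "field_function N J"
    and e_bij: "bij_betw e {1..N} UNIV"
    and e_less: "\<And>p q. 1 \<le> p \<Longrightarrow> p < q \<Longrightarrow> q \<le> N \<Longrightarrow> e p < e q"
begin

definition D :: "real set" where
  "D = {t\<in>{0..1}. J t \<noteq> -\<infinity>}"

text \<open>This represents \<open>F\<close> only at points of \<open>D\<close> off the nodes: at a
  node it contains the arbitrary real number \<open>K i 0\<close> in place of -infinity.\<close>

definition val :: "(real, 'n) vec \<Rightarrow> real \<Rightarrow> real" where
  "val y t = real_of_ereal (J t) + (\<Sum>i\<in>UNIV. K i (t - y $ i))"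

definition V :: "(real, 'n) vec \<Rightarrow> nat \<Rightarrow> real set" where
  "V y j = {t\<in>D. \<forall>p\<in>{1..N}. (p \<le> j \<longrightarrow> y $ e p < t) \<and> (j < p \<longrightarrow> t < y $ e p)}"

definition m :: "(real, 'n) vec \<Rightarrow> nat \<Rightarrow> real" where
  "m y j = Sup (val y ` V y j)"

definition Y :: "(real, 'n) vec set" where
  "Y = {y. \<forall>j\<le>N. V y j \<noteq> {}}"

definition node :: "(real, 'n) vec \<Rightarrow> nat \<Rightarrow> real" where
  "node y j = (if j = 0 then 0 else if j \<le> N then y $ e j else 1)"

lemma N_pos: "0 < N"
  by (simp add: N_card)

lemma kernel: "kernel_function (K i)"
  using singular by (simp add: singular_kernel_def)

lemma concave: "concave_on {-1<..<0} (K i)" "concave_on {0<..<1} (K i)"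
  using kernel by (auto simp: kernel_function_def)

lemma index_cases:
  obtains p where "1 \<le> p" "p \<le> N" "i = e p"
proof -
  have "i \<in> e ` {1..N}" using e_bij by (simp add: bij_betw_def)
  then show ?thesis using that by auto
qed

lemma e_less_iff:
  assumes "1 \<le> p" "p \<le> N" "1 \<le> q" "q \<le> N"
  shows "e p < e q \<longleftrightarrow> p < q"
  using e_less[of p q] e_less[of q p] assms
  by (cases p q rule: linorder_cases) auto

lemma sum_UNIV_e: "(\<Sum>i\<in>UNIV. f i) = (\<Sum>p=1..N. f (e p))"
  by (rule sum.reindex_bij_betw[OF e_bij, symmetric])

lemma D_bounds: "t \<in> D \<Longrightarrow> 0 \<le> t \<and> t \<le> 1"
  by (simp add: D_def)

lemma V_subset_D: "V y j \<subseteq> D"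
  by (auto simp: V_def)

lemma V_left: "t \<in> V y j \<Longrightarrow> 1 \<le> p \<Longrightarrow> p \<le> j \<Longrightarrow> p \<le> N \<Longrightarrow> y $ e p < t"
  and V_right: "t \<in> V y j \<Longrightarrow> j < p \<Longrightarrow> p \<le> N \<Longrightarrow> t < y $ e p"
  by (auto simp: V_def)

lemma V_not_node: "t \<in> V y j \<Longrightarrow> t \<noteq> y $ i"
proof (rule index_cases[of i])
  fix p assume "t \<in> V y j" and p: "1 \<le> p" "p \<le> N" "i = e p"
  then show ?thesis
    using V_left[of t y j p] V_right[of t y j p] by (cases "p \<le> j") auto
qed

lemma V_less:
  assumes "s \<in> V y j" "t \<in> V y k" "j < k" "k \<le> N"
  shows "s < t"
  using V_right[OF assms(1,3,4)] V_left[OF assms(2), of k] assms by simp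

text \<open>Points \<open>t j\<close> chosen from the sets \<open>V y j\<close> separate consecutive
  coordinates, and \<open>t 0\<close> and \<open>t N\<close> separate all coordinates from the
  endpoints 0 and 1.\<close>

lemma Y_subset_simplexS: "Y \<subseteq> simplexS"
proof
  fix y assume y: "y \<in> Y"
  then have "\<forall>j. \<exists>t. j \<le> N \<longrightarrow> t \<in> V y j"
    by (auto simp: Y_def)
  then obtain t where t: "\<And>j. j \<le> N \<Longrightarrow> t j \<in> V y j"
    by metis
  have tD: "0 \<le> t j" "t j \<le> 1" if "j \<le> N" for j
    using D_bounds V_subset_D t[OF that] by blast+
  have "0 < y $ i \<and> y $ i < 1" for i
  proof (rule index_cases[of i])
    fix p assume p: "1 \<le> p" "p \<le> N" "i = e p"
    have "t 0 < y $ e p" using V_right[OF t[of 0]] p by simp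
    moreover have "y $ e p < t N" using V_left[OF t[of N]] p by simp
    ultimately show ?thesis using tD[of 0] tD[of N] p by auto
  qed
  moreover have "y $ i < y $ j" if "i < j" for i j
  proof (rule index_cases[of i], rule index_cases[of j])
    fix p q assume p: "1 \<le> p" "p \<le> N" "i = e p" and q: "1 \<le> q" "q \<le> N" "j = e q"
    with that have "p < q" by (simp add: e_less_iff)
    then show ?thesis
      using V_left[OF t[of p], of p] V_right[OF t[of p], of q] p q by fastforce
  qed
  ultimately show "y \<in> simplexS" by (simp add: simplexS_def)
qed

lemma simplexS_bounds: "y \<in> simplexS \<Longrightarrow> 0 < y $ i \<and> y $ i < 1"
  by (simp add: simplexS_def)

lemma simplexS_mono:
  assumes "y \<in> simplexS" "1 \<le> p" "p \<le> q" "q \<le> N"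
  shows "y $ e p \<le> y $ e q"
  using assms e_less[of p q] by (cases "p = q") (auto simp: simplexS_def less_imp_le)

section \<open>Upper bounds and approximation of the suprema\<close>

lemma kernels_bounded_above:
  obtains C where "0 \<le> C" "\<And>i s. -1 < s \<Longrightarrow> s < 1 \<Longrightarrow> s \<noteq> 0 \<Longrightarrow> K i s \<le> C"
proof -
  have "\<exists>C. \<forall>s. -1 < s \<and> s < 1 \<and> s \<noteq> 0 \<longrightarrow> K i s \<le> C" for i
  proof -
    obtain A where A: "\<And>t. t \<in> {-1<..<0} \<Longrightarrow> K i t \<le> A"
      using concave_on_bounded_above[OF concave(1)] by metis
    obtain B where B: "\<And>t. t \<in> {0<..<1} \<Longrightarrow> K i t \<le> B"
      using concave_on_bounded_above[OF concave(2)] by metis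
    have "K i s \<le> max A B" if "-1 < s \<and> s < 1 \<and> s \<noteq> 0" for s
      using A[of s] B[of s] that by (cases "s < 0") auto
    then show ?thesis by blast
  qed
  then obtain C where C: "\<And>i s. -1 < s \<Longrightarrow> s < 1 \<Longrightarrow> s \<noteq> 0 \<Longrightarrow> K i s \<le> C i"
    by metis
  have "C i \<le> (\<Sum>i\<in>UNIV. \<bar>C i\<bar>)" for i
    using member_le_sum[of i UNIV "\<lambda>i. \<bar>C i\<bar>"] by auto
  then have "K i s \<le> (\<Sum>i\<in>UNIV. \<bar>C i\<bar>)" if "-1 < s" "s < 1" "s \<noteq> 0" for i s
    using C[OF that] order_trans by blast
  then show ?thesis using that[of "\<Sum>i\<in>UNIV. \<bar>C i\<bar>"] by (auto intro: sum_nonneg)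
qed

lemma J_bounded_above:
  obtains M where "\<And>t. t \<in> D \<Longrightarrow> real_of_ereal (J t) \<le> M"
proof -
  obtain M where M: "\<forall>t\<in>{0..1}. J t \<le> ereal M" and fin: "\<forall>t\<in>{0..1}. J t \<noteq> \<infinity>"
    using field unfolding field_function_def by blast
  have "real_of_ereal (J t) \<le> M" if "t \<in> D" for t
    using M that by (cases "J t") (auto simp: D_def dest!: bspec[of _ _ t])
  then show ?thesis using that by blast
qed

lemma val_bounded_above:
  obtains M where "\<And>y t. y \<in> simplexS \<Longrightarrow> t \<in> D \<Longrightarrow> (\<And>i. t \<noteq> y $ i) \<Longrightarrow> val y t \<le> M"
proof -
  obtain M where M: "\<And>t. t \<in> D \<Longrightarrow> real_of_ereal (J t) \<le> M"
    using J_bounded_above by blast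
  obtain C where C: "\<And>i s. -1 < s \<Longrightarrow> s < 1 \<Longrightarrow> s \<noteq> 0 \<Longrightarrow> K i s \<le> C"
    using kernels_bounded_above by metis
  have "val y t \<le> M + (\<Sum>i\<in>(UNIV::'n set). C)" if "y \<in> simplexS" "t \<in> D" "\<And>i. t \<noteq> y $ i" for y t
    unfolding val_def
  proof (intro add_mono sum_mono M C that)
    fix i
    show "-1 < t - y $ i" "t - y $ i < 1" "t - y $ i \<noteq> 0"
      using simplexS_bounds[OF that(1), of i] D_bounds[OF that(2)] that(3)[of i] by auto
  qed
  then show ?thesis using that by blast
qed

lemma val_bdd_above:
  assumes "y \<in> simplexS"
  shows "bdd_above (val y ` V y j)"
proof -
  obtain M where "\<And>y t. y \<in> simplexS \<Longrightarrow> t \<in> D \<Longrightarrow> (\<And>i. t \<noteq> y $ i) \<Longrightarrow> val y t \<le> M"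
    using val_bounded_above by blast
  then show ?thesis
    using assms V_not_node V_subset_D by (intro bdd_above.I2[where M = M]) blast
qed

lemma val_le_m: "y \<in> simplexS \<Longrightarrow> t \<in> V y j \<Longrightarrow> val y t \<le> m y j"
  unfolding m_def by (intro cSup_upper val_bdd_above) auto

lemma m_approx:
  assumes "y \<in> Y" "j \<le> N" "0 < \<epsilon>"
  obtains t where "t \<in> V y j" "m y j - \<epsilon> < val y t"
proof -
  have "V y j \<noteq> {}" using assms by (auto simp: Y_def)
  then have "\<exists>v\<in>val y ` V y j. m y j - \<epsilon> < v"
    using less_cSup_iff[of "val y ` V y j" "m y j - \<epsilon>"] val_bdd_above assms Y_subset_simplexS
    unfolding m_def by auto
  then show ?thesis using that by auto
qed

section \<open>Identification with the extended-valued suprema\<close>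

lemma Ffun_eq:
  assumes y: "y \<in> simplexS" and t: "t \<in> {0..1}"
  shows "Ffun J K y t = (if t \<in> D \<and> (\<forall>i. t \<noteq> y $ i) then ereal (val y t) else -\<infinity>)"
proof -
  have Jfin: "J t \<noteq> \<infinity>" using field t by (auto simp: field_function_def)
  \<comment> \<open>In the open simplex \<open>t - y $ i\<close> never reaches -1 or 1, so the only
    extended value that can occur is the singular one at 0.\<close>
  have k: "kext (K i) (t - y $ i) = (if t = y $ i then -\<infinity> else ereal (K i (t - y $ i)))" for i
    using simplexS_bounds[OF y, of i] t singular[of i]
    by (auto simp: kext_def singular_kernel_def)
  show ?thesis
  proof (cases "\<exists>i. t = y $ i")
    case True
    then obtain i where i: "t = y $ i" by blast
    have "(\<Sum>i\<in>UNIV. kext (K i) (t - y $ i))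
        = kext (K i) (t - y $ i) + (\<Sum>i\<in>UNIV - {i}. kext (K i) (t - y $ i))"
      by (rule sum.remove) auto
    moreover have "(\<Sum>i\<in>UNIV - {i}. kext (K i) (t - y $ i)) \<noteq> \<infinity>"
      by (auto simp: sum_Pinfty k split: if_splits)
    ultimately have "(\<Sum>i\<in>UNIV. kext (K i) (t - y $ i)) = -\<infinity>"
      using i k[of i] by simp
    then show ?thesis using True Jfin by (auto simp: Ffun_def)
  next
    case False
    then have "(\<Sum>i\<in>UNIV. kext (K i) (t - y $ i)) = ereal (\<Sum>i\<in>UNIV. K i (t - y $ i))"
      by (simp add: k)
    then show ?thesis using False t Jfin
      by (cases "J t") (auto simp: Ffun_def val_def D_def)
  qed
qed

text \<open>The strict inequalities in \<open>V\<close> only discard the nodes taken from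
  \<open>y\<close>. The outer endpoints 0 and 1 stay admissible, as they must, since the field may
  be finite there.\<close>

lemma V_eq_interval:
  assumes y: "y \<in> simplexS" and j: "j \<le> N"
  shows "V y j = {t\<in>{node y j..node y (Suc j)}. t \<in> D \<and> (\<forall>i. t \<noteq> y $ i)}"
proof (intro set_eqI iffI)
  fix t assume t: "t \<in> V y j"
  then have "t \<in> D" using V_subset_D by blast
  moreover have "node y j \<le> t"
    using V_left[OF t, of j] D_bounds[OF \<open>t \<in> D\<close>] j by (auto simp: node_def)
  moreover have "t \<le> node y (Suc j)"
    using V_right[OF t, of "Suc j"] D_bounds[OF \<open>t \<in> D\<close>] j by (auto simp: node_def)
  ultimately show "t \<in> {t\<in>{node y j..node y (Suc j)}. t \<in> D \<and> (\<forall>i. t \<noteq> y $ i)}"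
    using V_not_node[OF t] by auto
next
  fix t assume "t \<in> {t\<in>{node y j..node y (Suc j)}. t \<in> D \<and> (\<forall>i. t \<noteq> y $ i)}"
  then have t: "node y j \<le> t" "t \<le> node y (Suc j)" "t \<in> D" "\<And>i. t \<noteq> y $ i" by auto
  have "y $ e p < t" if "1 \<le> p" "p \<le> N" "p \<le> j" for p
    using simplexS_mono[OF y that(1,3) j] t(1) t(4)[of "e p"] that j by (simp add: node_def)
  moreover have "t < y $ e p" if "1 \<le> p" "p \<le> N" "j < p" for p
    using simplexS_mono[OF y, of "Suc j" p] t(2) t(4)[of "e p"] that j by (simp add: node_def)
  ultimately show "t \<in> V y j" using t(3) by (auto simp: V_def)
qed

lemma Sup_Ffun_interval:
  assumes y: "y \<in> simplexS" and j: "j \<le> N"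
  shows "Sup (Ffun J K y ` {node y j..node y (Suc j)}) = (if V y j = {} then -\<infinity> else ereal (m y j))"
    (is "Sup (_ ` ?A) = _")
proof -
  have A: "?A \<subseteq> {0..1}"
    using simplexS_bounds[OF y] by (auto simp: node_def less_imp_le intro: order_trans)
  have F: "Ffun J K y t = (if t \<in> V y j then ereal (val y t) else -\<infinity>)" if "t \<in> ?A" for t
  proof -
    have "t \<in> {0..1}" using that A by blast
    then show ?thesis using Ffun_eq[OF y] that unfolding V_eq_interval[OF y j] by auto
  qed
  have VA: "V y j \<subseteq> ?A" using V_eq_interval[OF y j] by blast
  show ?thesis
  proof (cases "V y j = {}")
    case True
    then have "Sup (Ffun J K y ` ?A) \<le> -\<infinity>"
      by (intro SUP_least) (simp add: F)
    then show ?thesis using True by simp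
  next
    case False
    then obtain w where w: "w \<in> V y j" by blast
    let ?s = "Sup (Ffun J K y ` ?A)"
    have up: "?s \<le> ereal (m y j)"
      by (intro SUP_least) (simp add: F val_le_m y)
    have ge: "ereal (val y t) \<le> ?s" if "t \<in> V y j" for t
      using F[of t] that VA by (metis SUP_upper subsetD)
    from up ge[OF w] obtain r where r: "?s = ereal r"
      by (cases ?s) auto
    have "m y j \<le> r"
      unfolding m_def using False ge r by (intro cSup_least) auto
    with up r False show ?thesis by (auto intro: antisym)
  qed
qed

lemma next_pt_e:
  assumes "1 \<le> p" "p \<le> N"
  shows "next_pt y (e p) = node y (Suc p)"
proof (cases "p < N")
  case True
  have "(LEAST j. e p < j) = e (Suc p)"
  proof (rule Least_equality)
    show "e p < e (Suc p)" using True assms by (simp add: e_less)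
    fix i assume i: "e p < i"
    show "e (Suc p) \<le> i"
    proof (rule index_cases[of i])
      fix q assume q: "1 \<le> q" "q \<le> N" "i = e q"
      with i assms have "p < q" by (simp add: e_less_iff)
      then show ?thesis using e_less[of "Suc p" q] q by (cases "Suc p = q") auto
    qed
  qed
  moreover have "\<exists>j. e p < j" using e_less[of p "Suc p"] True assms by auto
  ultimately show ?thesis using True by (simp add: next_pt_def node_def)
next
  case False
  have "\<not> e p < i" for i
    by (rule index_cases[of i]) (use False assms in \<open>simp add: e_less_iff\<close>)
  then show ?thesis using False by (simp add: next_pt_def node_def)
qed

lemma prev_pt_e:
  assumes "1 \<le> p" "p \<le> N"
  shows "prev_pt y (e p) = node y (p - 1)"
proof (cases "1 < p")
  case True
  have "(GREATEST j. j < e p) = e (p - 1)"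
  proof (rule Greatest_equality)
    show "e (p - 1) < e p" using True assms by (simp add: e_less)
    fix i assume i: "i < e p"
    show "i \<le> e (p - 1)"
    proof (rule index_cases[of i])
      fix q assume q: "1 \<le> q" "q \<le> N" "i = e q"
      with i assms have "q < p" by (simp add: e_less_iff)
      then show ?thesis using e_less[of q "p - 1"] q assms by (cases "q = p - 1") (auto simp: less_imp_le)
    qed
  qed
  moreover have "\<exists>j. j < e p"
    using e_less[of "p - 1" p] True assms by (intro exI[of _ "e (p - 1)"]) simp
  ultimately show ?thesis using True assms by (simp add: prev_pt_def node_def)
next
  case False
  have "\<not> i < e p" for i
    by (rule index_cases[of i]) (use False assms in \<open>simp add: e_less_iff\<close>)
  then show ?thesis using False assms by (simp add: prev_pt_def node_def)
qed

lemma m_after_e: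
  assumes "y \<in> simplexS" "1 \<le> p" "p \<le> N"
  shows "m_after J K y (e p) = (if V y p = {} then -\<infinity> else ereal (m y p))"
  using Sup_Ffun_interval[OF assms(1,3)] assms next_pt_e[of p y]
  by (simp add: m_after_def node_def)

lemma m_before_e:
  assumes "y \<in> simplexS" "1 \<le> p" "p \<le> N"
  shows "m_before J K y (e p) = (if V y (p - 1) = {} then -\<infinity> else ereal (m y (p - 1)))"
proof -
  have "node y (Suc (p - 1)) = y $ e p" using assms by (simp add: node_def)
  then show ?thesis
    using Sup_Ffun_interval[OF assms(1), of "p - 1"] assms prev_pt_e[of p y]
    by (simp add: m_before_def)
qed

lemma regY_eq: "regY J K = Y"
proof (intro equalityI subsetI)
  fix y assume "y \<in> regY J K"
  then have y: "y \<in> simplexS" and m: "\<And>i. m_after J K y i \<noteq> -\<infinity>" "\<And>i. m_before J K y i \<noteq> -\<infinity>"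
    by (auto simp: regY_def)
  have "V y j \<noteq> {}" if "j \<le> N" for j
  \<comment> \<open>The interval with index 0 is seen only by \<open>m_before\<close> at the first
    coordinate; every other one is the \<open>m_after\<close> of its own coordinate.\<close>
  proof (cases "j = 0")
    case True
    then show ?thesis using m_before_e[OF y, of 1] m(2)[of "e 1"] N_pos by (auto split: if_splits)
  next
    case False
    then show ?thesis using m_after_e[OF y, of j] m(1)[of "e j"] that by (auto split: if_splits)
  qed
  then show "y \<in> Y" by (simp add: Y_def)
next
  fix y assume y: "y \<in> Y"
  then have s: "y \<in> simplexS" using Y_subset_simplexS by blast
  have "m_after J K y i \<noteq> -\<infinity> \<and> m_before J K y i \<noteq> -\<infinity>" for i
    by (rule index_cases[of i]) (use y m_after_e[OF s] m_before_e[OF s] in \<open>simp add: Y_def\<close>)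
  then show "y \<in> regY J K" using s by (simp add: regY_def)
qed

lemma Phi_e:
  assumes "y \<in> Y" "1 \<le> p" "p \<le> N"
  shows "Phi J K y $ e p = m y p - m y (p - 1)"
proof -
  have "y \<in> simplexS" "V y p \<noteq> {}" "V y (p - 1) \<noteq> {}"
    using assms Y_subset_simplexS by (auto simp: Y_def)
  then show ?thesis using assms by (simp add: Phi_def m_after_e m_before_e)
qed

section \<open>The inverse of the difference function is Lipschitz\<close>

text \<open>Only the two ends of the interval have to be compared: all other coordinates of
  \<open>x\<close> lie beyond its own ends by monotonicity.\<close>

lemma V_subset_V:
  assumes x: "x \<in> simplexS" and y: "y \<in> simplexS" and j: "j \<le> N"
    and "node x j \<le> node y j" "node y (Suc j) \<le> node x (Suc j)"
  shows "V y j \<subseteq> V x j"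
proof
  fix t assume t: "t \<in> V y j"
  have "x $ e p < t" if "1 \<le> p" "p \<le> N" "p \<le> j" for p
  proof -
    have "x $ e p \<le> node x j" using simplexS_mono[OF x that(1,3) j] that j by (simp add: node_def)
    also have "\<dots> \<le> node y j" by fact
    also have "\<dots> < t" using V_left[OF t, of j] that j by (simp add: node_def)
    finally show ?thesis .
  qed
  moreover have "t < x $ e p" if "1 \<le> p" "p \<le> N" "j < p" for p
  proof -
    have "t < node y (Suc j)" using V_right[OF t, of "Suc j"] that by (simp add: node_def)
    also have "\<dots> \<le> node x (Suc j)" by fact
    also have "\<dots> \<le> x $ e p" using simplexS_mono[OF x, of "Suc j" p] that by (simp add: node_def)
    finally show ?thesis .
  qed
  ultimately show "t \<in> V x j" using V_subset_D t by (auto simp: V_def)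
qed

text \<open>This is the discrete column sum for coordinate \<open>i\<close>. If
  \<open>i = e p\<close>, a common point \<open>z j\<close> lies left of \<open>x $ i\<close> for
  \<open>j < p\<close> and right of \<open>y $ i\<close> for \<open>p \<le> j\<close>, never in the
  gap. Thus the three parts of \<open>kernel_shift\<close> give the three conditions of
  \<open>sum_by_parts_jump_le\<close>, and \<open>s p = 1\<close> expresses
  \<open>x $ i < y $ i\<close>.\<close>

lemma kernel_sum_le_aux:
  assumes x: "x \<in> simplexS" and y: "y \<in> simplexS"
    and s_def: "s = (\<lambda>j. sgn (node y j - node x j))"
    and z: "\<And>j. j \<le> N \<Longrightarrow> s j \<noteq> s (Suc j) \<Longrightarrow> z j \<in> V x j \<inter> V y j"
    and less: "x $ i < y $ i"
  shows "(\<Sum>j\<le>N. (s j - s (Suc j)) * (K i (z j - y $ i) - K i (z j - x $ i))) \<le> - (c * (y $ i - x $ i))"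
proof (rule index_cases[of i])
  fix p assume p: "1 \<le> p" "p \<le> N" "i = e p"
  note sh = kernel_shift[OF kernel[of i] pm[of i], of "x $ i" "y $ i"]
  have xy: "0 < x $ i" "y $ i < 1" using simplexS_bounds x y by blast+
  have zmono: "z j \<le> z k" if "j \<le> k" "k \<le> N" "s j \<noteq> s (Suc j)" "s k \<noteq> s (Suc k)" for j k
  proof (cases "j = k")
    case False
    then show ?thesis using V_less[of "z j" x j "z k" k] z[of j] z[of k] that by auto
  qed simp
  have zb: "0 \<le> z j" "z j \<le> 1" if "j \<le> N" "s j \<noteq> s (Suc j)" for j
    using z[OF that] V_subset_D D_bounds by blast+
  have zl: "z j < x $ i" if "j < p" "s j \<noteq> s (Suc j)" for j
    using z[of j] that p V_right[of "z j" x j p] by auto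
  have zr: "y $ i < z j" if "p \<le> j" "j \<le> N" "s j \<noteq> s (Suc j)" for j
    using z[of j] that p V_left[of "z j" y j p] by auto
  show ?thesis
  proof (rule sum_by_parts_jump_le[where p = p])
    show "s 0 = 0" "s (Suc N) = 0" by (auto simp: s_def node_def)
    show "s p = 1" using p less by (simp add: s_def node_def)
    show "p \<le> N" by fact
    show "s j \<le> 1" for j by (simp add: s_def sgn_if)
    show "K i (z j - y $ i) - K i (z j - x $ i) \<le> K i (z k - y $ i) - K i (z k - x $ i)"
      if "j \<le> k" "k < p" "s j \<noteq> s (Suc j)" "s k \<noteq> s (Suc k)" for j k
      using sh(1)[of "z j" "z k"] zmono[of j k] zb[of j] zl[of k] that xy less p by auto
    show "K i (z j - y $ i) - K i (z j - x $ i) \<le> K i (z k - y $ i) - K i (z k - x $ i)"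
      if "p \<le> j" "j \<le> k" "k \<le> N" "s j \<noteq> s (Suc j)" "s k \<noteq> s (Suc k)" for j k
      using sh(2)[of "z j" "z k"] zmono[of j k] zb[of k] zr[of j] that xy less p by auto
    show "K i (z k - y $ i) - K i (z k - x $ i) + c * (y $ i - x $ i) \<le> K i (z j - y $ i) - K i (z j - x $ i)"
      if "j < p" "p \<le> k" "k \<le> N" "s j \<noteq> s (Suc j)" "s k \<noteq> s (Suc k)" for j k
      using sh(3)[of "z j" "z k"] zb[of j] zb[of k] zl[of j] zr[of k] that xy less p by auto
  qed
qed

lemma kernel_sum_le:
  assumes x: "x \<in> simplexS" and y: "y \<in> simplexS"
    and s_def: "s = (\<lambda>j. sgn (node y j - node x j))"
    and z: "\<And>j. j \<le> N \<Longrightarrow> s j \<noteq> s (Suc j) \<Longrightarrow> z j \<in> V x j \<inter> V y j"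
  shows "(\<Sum>j\<le>N. (s j - s (Suc j)) * (K i (z j - y $ i) - K i (z j - x $ i))) \<le> - (c * \<bar>y $ i - x $ i\<bar>)"
proof (cases "x $ i" "y $ i" rule: linorder_cases)
  case less
  then show ?thesis using kernel_sum_le_aux[OF x y s_def z less] by simp
next
  case equal
  then show ?thesis by simp
next
  case greater
  \<comment> \<open>Exchanging \<open>x\<close> and \<open>y\<close> reverses the sign of both
    factors, so each summand is unchanged.\<close>
  define s' where "s' = (\<lambda>j. sgn (node x j - node y j))"
  have s': "s' j = - s j" for j
    unfolding s'_def s_def by (metis minus_diff_eq sgn_minus)
  have "(\<Sum>j\<le>N. (s' j - s' (Suc j)) * (K i (z j - x $ i) - K i (z j - y $ i))) \<le> - (c * (x $ i - y $ i))"
    using z by (intro kernel_sum_le_aux[OF y x s'_def _ greater]) (auto simp: s')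
  moreover have "(s' j - s' (Suc j)) * (K i (z j - x $ i) - K i (z j - y $ i))
      = (s j - s (Suc j)) * (K i (z j - y $ i) - K i (z j - x $ i))" for j
    by (simp add: s' algebra_simps)
  ultimately show ?thesis using greater by simp
qed

text \<open>If \<open>s\<close> drops at \<open>j\<close>, the left end has not moved left and the
  right end has not moved right, so the interval of \<open>y\<close> lies in that of
  \<open>x\<close>. A near-maximum point for \<open>y\<close> then bounds \<open>m x j\<close> from
  below as well. If \<open>s\<close> rises, the roles are exchanged. The factor is at most 2 in
  absolute value, whence the accuracy \<open>\<epsilon> / 2\<close>.\<close>

lemma common_point:
  assumes x: "x \<in> Y" and y: "y \<in> Y" and j: "j \<le> N" and "0 < \<epsilon>"
    and s_def: "s = (\<lambda>j. sgn (node y j - node x j))" and ne: "s j \<noteq> s (Suc j)"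
  shows "\<exists>z\<in>V x j \<inter> V y j. (s j - s (Suc j)) * (m y j - m x j)
    \<le> (s j - s (Suc j)) * (val y z - val x z) + \<epsilon>"
proof -
  have xs: "x \<in> simplexS" and ys: "y \<in> simplexS" using x y Y_subset_simplexS by auto
  have s_cases: "s k = -1 \<or> s k = 0 \<or> s k = 1" for k by (auto simp: s_def sgn_if)
  have half: "0 < \<epsilon> / 2" using \<open>0 < \<epsilon>\<close> by simp
  show ?thesis
  proof (cases "s j > s (Suc j)")
    case True
    then have s: "s j \<ge> 0" "s (Suc j) \<le> 0" "s j - s (Suc j) \<le> 2"
      using s_cases[of j] s_cases[of "Suc j"] by auto
    then have "V y j \<subseteq> V x j"
      by (intro V_subset_V xs ys j) (auto simp: s_def)
    moreover obtain z where z: "z \<in> V y j" "m y j - \<epsilon> / 2 < val y z"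
      using m_approx[OF y j half] by blast
    ultimately have zx: "z \<in> V x j" by blast
    have "m y j - m x j \<le> val y z - val x z + \<epsilon> / 2"
      using val_le_m[OF xs zx] z by simp
    then have "(s j - s (Suc j)) * (m y j - m x j) \<le> (s j - s (Suc j)) * (val y z - val x z + \<epsilon> / 2)"
      using True by (intro mult_left_mono) auto
    moreover have "(s j - s (Suc j)) * (\<epsilon> / 2) \<le> 2 * (\<epsilon> / 2)"
      using s half by (intro mult_right_mono) auto
    ultimately show ?thesis using z zx by (intro bexI[of _ z]) (auto simp: distrib_left)
  next
    case False
    with ne have lt: "s j < s (Suc j)" by simp
    then have s: "s j \<le> 0" "s (Suc j) \<ge> 0" "s (Suc j) - s j \<le> 2"
      using s_cases[of j] s_cases[of "Suc j"] by auto
    then have "V x j \<subseteq> V y j"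
      by (intro V_subset_V xs ys j) (auto simp: s_def)
    moreover obtain z where z: "z \<in> V x j" "m x j - \<epsilon> / 2 < val x z"
      using m_approx[OF x j half] by blast
    ultimately have zy: "z \<in> V y j" by blast
    have "m x j - m y j \<le> val x z - val y z + \<epsilon> / 2"
      using val_le_m[OF ys zy] z by simp
    then have "(s (Suc j) - s j) * (m x j - m y j) \<le> (s (Suc j) - s j) * (val x z - val y z + \<epsilon> / 2)"
      using lt by (intro mult_left_mono) auto
    moreover have "(s (Suc j) - s j) * (\<epsilon> / 2) \<le> 2 * (\<epsilon> / 2)"
      using s half by (intro mult_right_mono) auto
    ultimately show ?thesis using z zy by (intro bexI[of _ z]) (auto simp: algebra_simps)
  qed
qed

text \<open>Test the increment of \<open>\<Phi>\<close> against the signs of the increments of the nodes. After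
  summation by parts only those intervals survive at whose ends the signs differ, and for these one
  of the intervals of \<open>x\<close> and \<open>y\<close> contains the other, so that the suprema can be compared
  at a common point.\<close>
lemma Phi_expanding_l1:
  assumes x: "x \<in> Y" and y: "y \<in> Y"
  shows "c * (\<Sum>i\<in>UNIV. \<bar>y $ i - x $ i\<bar>) \<le> (\<Sum>i\<in>UNIV. \<bar>Phi J K y $ i - Phi J K x $ i\<bar>)"
proof (rule field_le_epsilon)
  fix \<epsilon> :: real assume "0 < \<epsilon>"
  have xs: "x \<in> simplexS" and ys: "y \<in> simplexS" using x y Y_subset_simplexS by auto
  define s where "s = (\<lambda>j. sgn (node y j - node x j))"
  define \<delta> where "\<delta> = \<epsilon> / Suc N"
  have \<delta>: "0 < \<delta>" "Suc N * \<delta> = \<epsilon>" using \<open>0 < \<epsilon>\<close> by (auto simp: \<delta>_def)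
  define d where "d j = m y j - m x j" for j
  have "\<forall>j. \<exists>z. j \<le> N \<and> s j \<noteq> s (Suc j) \<longrightarrow> z \<in> V x j \<inter> V y j \<and>
      (s j - s (Suc j)) * d j \<le> (s j - s (Suc j)) * (val y z - val x z) + \<delta>"
    using common_point[OF x y _ \<delta>(1) s_def] unfolding d_def by blast
  then obtain z where z: "\<And>j. j \<le> N \<Longrightarrow> s j \<noteq> s (Suc j) \<Longrightarrow> z j \<in> V x j \<inter> V y j"
    and dz: "\<And>j. j \<le> N \<Longrightarrow> s j \<noteq> s (Suc j) \<Longrightarrow>
      (s j - s (Suc j)) * d j \<le> (s j - s (Suc j)) * (val y (z j) - val x (z j)) + \<delta>"
    by metis
  have dPhi: "Phi J K y $ e p - Phi J K x $ e p = d p - d (p - 1)" if "p \<in> {1..N}" for p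
    using Phi_e[OF x, of p] Phi_e[OF y, of p] that by (simp add: d_def)
  have "- (\<Sum>p=1..N. \<bar>Phi J K y $ e p - Phi J K x $ e p\<bar>) \<le> (\<Sum>p=1..N. s p * (d p - d (p - 1)))"
    unfolding sum_negf[symmetric]
  proof (rule sum_mono)
    fix p assume "p \<in> {1..N}"
    then show "- \<bar>Phi J K y $ e p - Phi J K x $ e p\<bar> \<le> s p * (d p - d (p - 1))"
      unfolding dPhi[OF \<open>p \<in> {1..N}\<close>] by (auto simp: s_def sgn_if)
  qed
  \<comment> \<open>The boundary terms vanish because the outer nodes 0 and 1 do not move, so
    \<open>s 0 = s (Suc N) = 0\<close>.\<close>
  also have "\<dots> = (\<Sum>j\<le>N. (s j - s (Suc j)) * d j)"
    unfolding sum_by_parts by (simp add: s_def node_def)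
  also have "\<dots> \<le> (\<Sum>j\<le>N. (s j - s (Suc j)) * (val y (z j) - val x (z j)) + \<delta>)"
  proof (rule sum_mono)
    fix j assume "j \<in> {..N}"
    then show "(s j - s (Suc j)) * d j \<le> (s j - s (Suc j)) * (val y (z j) - val x (z j)) + \<delta>"
      using dz[of j] \<delta>(1) by (cases "s j = s (Suc j)") auto
  qed
  \<comment> \<open>The field cancels, both values being taken at the same point; the
    \<open>Suc N\<close> errors \<open>\<delta>\<close> add up to \<open>\<epsilon>\<close>.\<close>
  also have "\<dots> = (\<Sum>j\<le>N. \<Sum>i\<in>UNIV. (s j - s (Suc j)) * (K i (z j - y $ i) - K i (z j - x $ i))) + \<epsilon>"
    using \<delta>(2) by (simp add: sum.distrib val_def sum_distrib_left sum_subtractf algebra_simps)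
  also have "(\<Sum>j\<le>N. \<Sum>i\<in>UNIV. (s j - s (Suc j)) * (K i (z j - y $ i) - K i (z j - x $ i)))
      = (\<Sum>i\<in>UNIV. \<Sum>j\<le>N. (s j - s (Suc j)) * (K i (z j - y $ i) - K i (z j - x $ i)))"
    by (rule sum.swap)
  also have "\<dots> \<le> (\<Sum>i\<in>UNIV. - (c * \<bar>y $ i - x $ i\<bar>))"
    by (intro sum_mono kernel_sum_le[OF xs ys s_def z])
  also have "\<dots> = - (c * (\<Sum>i\<in>UNIV. \<bar>y $ i - x $ i\<bar>))"
    by (simp add: sum_negf sum_distrib_left)
  finally show "c * (\<Sum>i\<in>UNIV. \<bar>y $ i - x $ i\<bar>)
      \<le> (\<Sum>i\<in>UNIV. \<bar>Phi J K y $ i - Phi J K x $ i\<bar>) + \<epsilon>"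
    unfolding sum_UNIV_e[of "\<lambda>i. \<bar>Phi J K y $ i - Phi J K x $ i\<bar>"] by linarith
qed

lemma Phi_expanding:
  assumes x: "x \<in> Y" and y: "y \<in> Y"
  shows "dist x y \<le> real N / c * dist (Phi J K x) (Phi J K y)"
proof -
  have "c * dist x y \<le> c * (\<Sum>i\<in>UNIV. \<bar>(y - x) $ i\<bar>)"
    using norm_le_l1_cart[of "y - x"] c_pos by (simp add: dist_norm norm_minus_commute)
  also have "\<dots> \<le> (\<Sum>i\<in>UNIV. \<bar>(Phi J K y - Phi J K x) $ i\<bar>)"
    using Phi_expanding_l1[OF x y] by simp
  also have "\<dots> \<le> (\<Sum>i\<in>(UNIV::'n set). dist (Phi J K x) (Phi J K y))"
    by (intro sum_mono) (metis component_le_norm_cart dist_commute dist_norm)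
  finally show ?thesis using c_pos by (simp add: field_simps N_card)
qed

section \<open>Local Lipschitz continuity\<close>

lemma isCont_kernel:
  assumes "-1 < s" "s < 1" "s \<noteq> 0"
  shows "isCont (K i) s"
proof (cases "s < 0")
  case True
  then show ?thesis
    using concave_on_continuous_on[OF concave(1)[of i]] assms
    by (simp add: continuous_on_eq_continuous_at)
next
  case False
  then show ?thesis
    using concave_on_continuous_on[OF concave(2)[of i]] assms
    by (simp add: continuous_on_eq_continuous_at)
qed

lemma kernels_eventually_below:
  obtains \<eta> where "0 < \<eta>" "\<And>i s. s \<noteq> 0 \<Longrightarrow> \<bar>s\<bar> < \<eta> \<Longrightarrow> K i s < R"
proof -
  have "\<forall>\<^sub>F s in at 0. \<forall>i\<in>(UNIV::'n set). K i s < R"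
    using singular_kernel_at_bot[OF singular]
    by (intro eventually_ball_finite) (auto simp: filterlim_at_bot_dense)
  then show ?thesis using that by (auto simp: eventually_at)
qed

text \<open>The field and all other kernels are bounded above, so a value of at least
  \<open>B\<close> excludes that one kernel is very negative. It is essential that
  \<open>\<eta>\<close> depends on \<open>B\<close> alone and not on \<open>y\<close>.\<close>

lemma large_val_away_from_nodes:
  obtains \<eta> where "0 < \<eta>"
    "\<And>y t j i. y \<in> simplexS \<Longrightarrow> t \<in> V y j \<Longrightarrow> B \<le> val y t \<Longrightarrow> \<eta> \<le> \<bar>t - y $ i\<bar>"
proof -
  obtain M where M: "\<And>t. t \<in> D \<Longrightarrow> real_of_ereal (J t) \<le> M"
    using J_bounded_above by blast
  obtain C where C0: "0 \<le> C" and C: "\<And>i s. -1 < s \<Longrightarrow> s < 1 \<Longrightarrow> s \<noteq> 0 \<Longrightarrow> K i s \<le> C"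
    using kernels_bounded_above by metis
  obtain \<eta> where \<eta>: "0 < \<eta>" "\<And>i s. s \<noteq> 0 \<Longrightarrow> \<bar>s\<bar> < \<eta> \<Longrightarrow> K i s < B - M - real N * C"
    using kernels_eventually_below by metis
  have "\<eta> \<le> \<bar>t - y $ i\<bar>" if y: "y \<in> simplexS" and t: "t \<in> V y j" and B: "B \<le> val y t" for y t j i
  proof (rule ccontr)
    assume "\<not> ?thesis"
    then have "K i (t - y $ i) < B - M - real N * C"
      using \<eta>(2)[of "t - y $ i" i] V_not_node[OF t, of i] by simp
    moreover have tD: "t \<in> D" using t V_subset_D by blast
    have "(\<Sum>k\<in>UNIV - {i}. K k (t - y $ k)) \<le> (\<Sum>k\<in>UNIV - {i}. C)"
    proof (rule sum_mono, rule C)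
      fix k
      show "-1 < t - y $ k" "t - y $ k < 1" "t - y $ k \<noteq> 0"
        using simplexS_bounds[OF y, of k] D_bounds[OF tD] V_not_node[OF t, of k] by auto
    qed
    moreover have "(\<Sum>k\<in>UNIV - {i}. C) \<le> real N * C"
      using C0 by (simp add: N_card mult_right_mono)
    moreover have "(\<Sum>k\<in>UNIV. K k (t - y $ k)) = K i (t - y $ i) + (\<Sum>k\<in>UNIV - {i}. K k (t - y $ k))"
      by (rule sum.remove) auto
    ultimately show False using B M[OF tD] unfolding val_def by linarith
  qed
  then show ?thesis using that \<eta>(1) by blast
qed

text \<open>The condition \<open>0 < u * v\<close> puts both arguments on the same branch; the
  bounds with \<open>\<eta>\<close> keep them away from 0 and from the outer ends, where slopes may
  be unbounded.\<close>

lemma kernels_lipschitz: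
  assumes "0 < \<eta>"
  obtains L where "0 \<le> L"
    "\<And>i u v. \<eta> \<le> \<bar>u\<bar> \<Longrightarrow> \<bar>u\<bar> \<le> 1 - \<eta> \<Longrightarrow> \<eta> \<le> \<bar>v\<bar> \<Longrightarrow> \<bar>v\<bar> \<le> 1 - \<eta> \<Longrightarrow> 0 < u * v \<Longrightarrow>
      \<bar>K i u - K i v\<bar> \<le> L * \<bar>u - v\<bar>"
proof -
  have "\<exists>L\<ge>0. \<forall>u v. \<eta> \<le> \<bar>u\<bar> \<and> \<bar>u\<bar> \<le> 1 - \<eta> \<and> \<eta> \<le> \<bar>v\<bar> \<and> \<bar>v\<bar> \<le> 1 - \<eta> \<and> 0 < u * v \<longrightarrow>
      \<bar>K i u - K i v\<bar> \<le> L * \<bar>u - v\<bar>" for i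
  proof -
    obtain A where A: "0 \<le> A" "\<And>u v. u \<in> {- (1 - \<eta>)..- \<eta>} \<Longrightarrow> v \<in> {- (1 - \<eta>)..- \<eta>} \<Longrightarrow>
        \<bar>K i u - K i v\<bar> \<le> A * \<bar>u - v\<bar>"
      using concave_on_lipschitz_compact[OF concave(1), of "- (1 - \<eta>)" "- \<eta>"] assms by auto
    obtain B where B: "0 \<le> B" "\<And>u v. u \<in> {\<eta>..1 - \<eta>} \<Longrightarrow> v \<in> {\<eta>..1 - \<eta>} \<Longrightarrow>
        \<bar>K i u - K i v\<bar> \<le> B * \<bar>u - v\<bar>"
      using concave_on_lipschitz_compact[OF concave(2), of "\<eta>" "1 - \<eta>"] assms by auto
    have "\<bar>K i u - K i v\<bar> \<le> max A B * \<bar>u - v\<bar>"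
      if "\<eta> \<le> \<bar>u\<bar> \<and> \<bar>u\<bar> \<le> 1 - \<eta> \<and> \<eta> \<le> \<bar>v\<bar> \<and> \<bar>v\<bar> \<le> 1 - \<eta> \<and> 0 < u * v" for u v
    proof (cases "0 < u")
      case True
      then have "0 < v" using that by (simp add: zero_less_mult_iff)
      then have "\<bar>K i u - K i v\<bar> \<le> B * \<bar>u - v\<bar>" using True that by (intro B) auto
      also have "\<dots> \<le> max A B * \<bar>u - v\<bar>" by (intro mult_right_mono) auto
      finally show ?thesis .
    next
      case False
      then have "u < 0" "v < 0" using that by (auto simp: zero_less_mult_iff)
      then have "\<bar>K i u - K i v\<bar> \<le> A * \<bar>u - v\<bar>" using that by (intro A) auto
      also have "\<dots> \<le> max A B * \<bar>u - v\<bar>" by (intro mult_right_mono) auto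
      finally show ?thesis .
    qed
    then show ?thesis using A(1) by (intro exI[of _ "max A B"]) auto
  qed
  then obtain L where L0: "\<And>i. 0 \<le> L i" and
    L: "\<And>i u v. \<eta> \<le> \<bar>u\<bar> \<Longrightarrow> \<bar>u\<bar> \<le> 1 - \<eta> \<Longrightarrow> \<eta> \<le> \<bar>v\<bar> \<Longrightarrow> \<bar>v\<bar> \<le> 1 - \<eta> \<Longrightarrow> 0 < u * v \<Longrightarrow>
      \<bar>K i u - K i v\<bar> \<le> L i * \<bar>u - v\<bar>"
    by metis
  show ?thesis
  proof (rule that)
    show "0 \<le> (\<Sum>i\<in>UNIV. L i)" using L0 by (intro sum_nonneg)
    fix i u v
    assume *: "\<eta> \<le> \<bar>u\<bar>" "\<bar>u\<bar> \<le> 1 - \<eta>" "\<eta> \<le> \<bar>v\<bar>" "\<bar>v\<bar> \<le> 1 - \<eta>" "0 < u * v"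
    have "\<bar>K i u - K i v\<bar> \<le> L i * \<bar>u - v\<bar>" by (rule L[OF *])
    also have "\<dots> \<le> (\<Sum>i\<in>UNIV. L i) * \<bar>u - v\<bar>"
      using L0 by (intro mult_right_mono member_le_sum) auto
    finally show "\<bar>K i u - K i v\<bar> \<le> (\<Sum>i\<in>UNIV. L i) * \<bar>u - v\<bar>" .
  qed
qed

lemma V_same_side:
  assumes "t \<in> V a j" "t \<in> V b j"
  shows "0 < (t - a $ i) * (t - b $ i)"
proof (rule index_cases[of i])
  fix p assume p: "1 \<le> p" "p \<le> N" "i = e p"
  show ?thesis
  proof (cases "p \<le> j")
    case True
    then show ?thesis using p V_left[OF assms(1), of p] V_left[OF assms(2), of p] by simp
  next
    case False
    then show ?thesis using p V_right[OF assms(1), of p] V_right[OF assms(2), of p]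
      by (simp add: mult_neg_neg)
  qed
qed

text \<open>The field cancels at the common point \<open>t\<close>, so only the kernels have to be
  estimated.\<close>

lemma val_lipschitz:
  assumes "0 < \<eta>"
  obtains L where "0 \<le> L"
    "\<And>a b t j. t \<in> V a j \<Longrightarrow> t \<in> V b j \<Longrightarrow> (\<And>i. \<eta> \<le> \<bar>t - a $ i\<bar> \<and> \<bar>t - a $ i\<bar> \<le> 1 - \<eta>) \<Longrightarrow>
      (\<And>i. \<eta> \<le> \<bar>t - b $ i\<bar> \<and> \<bar>t - b $ i\<bar> \<le> 1 - \<eta>) \<Longrightarrow> \<bar>val a t - val b t\<bar> \<le> L * dist a b"
proof -
  obtain L where L0: "0 \<le> L" and
    L: "\<And>i u v. \<eta> \<le> \<bar>u\<bar> \<Longrightarrow> \<bar>u\<bar> \<le> 1 - \<eta> \<Longrightarrow> \<eta> \<le> \<bar>v\<bar> \<Longrightarrow> \<bar>v\<bar> \<le> 1 - \<eta> \<Longrightarrow> 0 < u * v \<Longrightarrow>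
      \<bar>K i u - K i v\<bar> \<le> L * \<bar>u - v\<bar>"
    using kernels_lipschitz[OF assms] by metis
  show ?thesis
  proof (rule that)
    show "0 \<le> real N * L" using L0 by simp
    fix a b t j
    assume t: "t \<in> V a j" "t \<in> V b j"
      and a: "\<And>i. \<eta> \<le> \<bar>t - a $ i\<bar> \<and> \<bar>t - a $ i\<bar> \<le> 1 - \<eta>"
      and b: "\<And>i. \<eta> \<le> \<bar>t - b $ i\<bar> \<and> \<bar>t - b $ i\<bar> \<le> 1 - \<eta>"
    have "\<bar>val a t - val b t\<bar> = \<bar>\<Sum>i\<in>UNIV. K i (t - a $ i) - K i (t - b $ i)\<bar>"
      by (simp add: val_def sum_subtractf)
    also have "\<dots> \<le> (\<Sum>i\<in>UNIV. \<bar>K i (t - a $ i) - K i (t - b $ i)\<bar>)"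
      by (rule sum_abs)
    also have "\<dots> \<le> (\<Sum>i\<in>(UNIV::'n set). L * dist a b)"
    proof (rule sum_mono)
      fix i
      have "\<bar>K i (t - a $ i) - K i (t - b $ i)\<bar> \<le> L * \<bar>(t - a $ i) - (t - b $ i)\<bar>"
        using a[of i] b[of i] V_same_side[OF t] by (intro L) auto
      also have "\<dots> \<le> L * dist a b"
        using dist_vec_nth_le[of a i b] L0 by (intro mult_left_mono) (auto simp: dist_real_def)
      finally show "\<bar>K i (t - a $ i) - K i (t - b $ i)\<bar> \<le> L * dist a b" .
    qed
    finally show "\<bar>val a t - val b t\<bar> \<le> real N * L * dist a b"
      by (simp add: N_card)
  qed
qed

lemma V_stable:
  assumes t: "t \<in> V a j" and near: "\<And>i. \<bar>a $ i - b $ i\<bar> < \<bar>t - a $ i\<bar>"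
  shows "t \<in> V b j"
proof -
  have "b $ e p < t" if "p \<in> {1..N}" "p \<le> j" for p
    using V_left[OF t, of p] near[of "e p"] that by auto
  moreover have "t < b $ e p" if "p \<in> {1..N}" "j < p" for p
    using V_right[OF t, of p] near[of "e p"] that by auto
  ultimately show ?thesis using t by (auto simp: V_def)
qed

text \<open>Two scales are involved. Fixed witnesses \<open>w j\<close> survive a motion of the
  nodes by \<open>\<rho>\<close>; this gives a ball inside \<open>Y\<close> and a common lower bound
  \<open>B\<close> of all \<open>m y j\<close> on it. That bound in turn determines the distance
  \<open>\<eta>\<close> of near-maximum points from the nodes, and hence the final radius and
  Lipschitz constant.\<close>

lemma m_locally_lipschitz:
  assumes x: "x \<in> Y"
  obtains r L where "0 < r" "0 \<le> L" "ball x r \<subseteq> Y"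
    "\<And>a b j. a \<in> ball x r \<Longrightarrow> b \<in> ball x r \<Longrightarrow> j \<le> N \<Longrightarrow> \<bar>m a j - m b j\<bar> \<le> L * dist a b"
proof -
  have xs: "x \<in> simplexS" using x Y_subset_simplexS by blast
  have "\<forall>j. \<exists>t. j \<le> N \<longrightarrow> t \<in> V x j" using x by (auto simp: Y_def)
  then obtain w where w: "\<And>j. j \<le> N \<Longrightarrow> w j \<in> V x j" by metis
  have wD: "w j \<in> D" if "j \<le> N" for j using w[OF that] V_subset_D by blast
  \<comment> \<open>These are the distances to be preserved: from the nodes to 0 and 1, which keeps
    \<open>t - y $ i\<close> away from -1 and 1, and from the witnesses to the nodes. Half of the
    least of them is left after a motion by \<open>\<rho>\<close>.\<close>
  define G where "G = range (\<lambda>i. x $ i) \<union> range (\<lambda>i. 1 - x $ i) \<union> (\<lambda>(j, i). \<bar>w j - x $ i\<bar>) ` ({..N} \<times> UNIV)"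
  have G: "finite G" "G \<noteq> {}" by (auto simp: G_def)
  have Gpos: "0 < g" if "g \<in> G" for g
    using that simplexS_bounds[OF xs] V_not_node[OF w] by (auto simp: G_def)
  define \<rho> where "\<rho> = Min G / 2"
  have \<rho>: "0 < \<rho>" using Gpos Min_in[OF G] by (simp add: \<rho>_def)
  have \<rho>G: "2 * \<rho> \<le> g" if "g \<in> G" for g using Min_le[OF G(1) that] by (simp add: \<rho>_def)
  have x\<rho>: "2 * \<rho> \<le> x $ i" "2 * \<rho> \<le> 1 - x $ i" for i
    by (auto intro!: \<rho>G simp: G_def)
  have w\<rho>: "2 * \<rho> \<le> \<bar>w j - x $ i\<bar>" if "j \<le> N" for i j
  proof (rule \<rho>G)
    have "(\<lambda>(j, i). \<bar>w j - x $ i\<bar>) (j, i) \<in> (\<lambda>(j, i). \<bar>w j - x $ i\<bar>) ` ({..N} \<times> UNIV)"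
      using that by (intro imageI) auto
    then show "\<bar>w j - x $ i\<bar> \<in> G" by (simp add: G_def)
  qed
  have nth: "\<bar>x $ i - y $ i\<bar> < s" if "y \<in> ball x s" for y i s
    using that dist_vec_nth_le[of x i y] by (simp add: dist_real_def)
  have wV: "w j \<in> V y j" if "y \<in> ball x \<rho>" "j \<le> N" for y j
  proof (rule V_stable[OF w[OF that(2)]])
    show "\<bar>x $ i - y $ i\<bar> < \<bar>w j - x $ i\<bar>" for i
      using nth[OF that(1), of i] w\<rho>[OF that(2), of i] \<rho> by linarith
  qed
  have ballY: "ball x \<rho> \<subseteq> Y" using wV unfolding Y_def by blast
  have far: "\<bar>t - y $ i\<bar> \<le> 1 - \<rho>" if "y \<in> ball x \<rho>" "t \<in> D" for y t i
    using nth[OF that(1), of i] x\<rho>[of i] D_bounds[OF that(2)] by linarith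
  obtain L1 where L1: "0 \<le> L1" "\<And>a b t j. t \<in> V a j \<Longrightarrow> t \<in> V b j \<Longrightarrow>
      (\<And>i. \<rho> \<le> \<bar>t - a $ i\<bar> \<and> \<bar>t - a $ i\<bar> \<le> 1 - \<rho>) \<Longrightarrow>
      (\<And>i. \<rho> \<le> \<bar>t - b $ i\<bar> \<and> \<bar>t - b $ i\<bar> \<le> 1 - \<rho>) \<Longrightarrow> \<bar>val a t - val b t\<bar> \<le> L1 * dist a b"
    using val_lipschitz[OF \<rho>] by metis
  define B where "B = Min ((\<lambda>j. val x (w j)) ` {..N}) - L1 * \<rho>"
  have mB: "B \<le> m y j" if y: "y \<in> ball x \<rho>" and j: "j \<le> N" for y j
  proof -
    have "\<bar>val x (w j) - val y (w j)\<bar> \<le> L1 * dist x y"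
    proof (rule L1(2))
      show "w j \<in> V x j" "w j \<in> V y j" using w wV y j by auto
      have "x \<in> ball x \<rho>" using \<rho> by simp
      then show "\<rho> \<le> \<bar>w j - x $ i\<bar> \<and> \<bar>w j - x $ i\<bar> \<le> 1 - \<rho>" for i
        using w\<rho>[OF j, of i] far[of x "w j" i] wD[OF j] \<rho> by auto
      show "\<rho> \<le> \<bar>w j - y $ i\<bar> \<and> \<bar>w j - y $ i\<bar> \<le> 1 - \<rho>" for i
        using w\<rho>[OF j, of i] nth[OF y, of i] far[OF y wD[OF j], of i] by linarith
    qed
    also have "\<dots> \<le> L1 * \<rho>" using y L1(1) by (intro mult_left_mono) auto
    finally have "val x (w j) - L1 * \<rho> \<le> val y (w j)" by linarith
    moreover have "Min ((\<lambda>j. val x (w j)) ` {..N}) \<le> val x (w j)" using j by simp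
    moreover have "val y (w j) \<le> m y j"
      using val_le_m wV[OF y j] ballY Y_subset_simplexS y by blast
    ultimately show ?thesis unfolding B_def by linarith
  qed
  obtain \<eta> where \<eta>: "0 < \<eta>"
    "\<And>y t j i. y \<in> simplexS \<Longrightarrow> t \<in> V y j \<Longrightarrow> B - 1 \<le> val y t \<Longrightarrow> \<eta> \<le> \<bar>t - y $ i\<bar>"
    using large_val_away_from_nodes[of "B - 1"] by metis
  define \<eta>' where "\<eta>' = min \<rho> (\<eta> / 2)"
  have \<eta>': "0 < \<eta>'" "\<eta>' \<le> \<rho>" "\<eta>' \<le> \<eta> / 2" using \<rho> \<eta>(1) by (auto simp: \<eta>'_def)
  obtain L where L: "0 \<le> L" "\<And>a b t j. t \<in> V a j \<Longrightarrow> t \<in> V b j \<Longrightarrow>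
      (\<And>i. \<eta>' \<le> \<bar>t - a $ i\<bar> \<and> \<bar>t - a $ i\<bar> \<le> 1 - \<eta>') \<Longrightarrow>
      (\<And>i. \<eta>' \<le> \<bar>t - b $ i\<bar> \<and> \<bar>t - b $ i\<bar> \<le> 1 - \<eta>') \<Longrightarrow> \<bar>val a t - val b t\<bar> \<le> L * dist a b"
    using val_lipschitz[OF \<eta>'(1)] by metis
  \<comment> \<open>Two points of this ball differ by less than \<open>\<eta> / 2\<close> in each
    coordinate, so a point at distance \<open>\<eta>\<close> from the nodes of one keeps at least
    \<open>\<eta> / 2\<close> from those of the other.\<close>
  define r where "r = min \<rho> (\<eta> / 4)"
  have r: "0 < r" "r \<le> \<rho>" "r \<le> \<eta> / 4" using \<rho> \<eta>(1) by (auto simp: r_def)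
  have one: "m a j \<le> m b j + L * dist a b" if a: "a \<in> ball x r" and b: "b \<in> ball x r" and j: "j \<le> N" for a b j
  proof (rule field_le_epsilon)
    fix \<epsilon> :: real assume "0 < \<epsilon>"
    have ab\<rho>: "a \<in> ball x \<rho>" "b \<in> ball x \<rho>" using a b r by auto
    then have abY: "a \<in> Y" "b \<in> Y" using ballY by auto
    then have abS: "a \<in> simplexS" "b \<in> simplexS" using Y_subset_simplexS by auto
    \<comment> \<open>The cap 1 on the error ensures \<open>B - 1 \<le> val a t\<close>, so
      \<open>\<eta>\<close> does not depend on \<open>\<epsilon>\<close>.\<close>
    obtain t where t: "t \<in> V a j" "m a j - min \<epsilon> 1 < val a t"
      using m_approx[OF abY(1) j, of "min \<epsilon> 1"] \<open>0 < \<epsilon>\<close> by auto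
    have tD: "t \<in> D" using t V_subset_D by blast
    have "B - 1 \<le> val a t" using t(2) mB[OF ab\<rho>(1) j] by linarith
    then have ta: "\<eta> \<le> \<bar>t - a $ i\<bar>" for i using \<eta>(2)[OF abS(1) t(1)] by blast
    have abn: "\<bar>a $ i - b $ i\<bar> < \<eta> / 2" for i
      using nth[OF a, of i] nth[OF b, of i] r by linarith
    have tb: "t \<in> V b j"
    proof (rule V_stable[OF t(1)])
      show "\<bar>a $ i - b $ i\<bar> < \<bar>t - a $ i\<bar>" for i using ta[of i] abn[of i] \<eta>(1) by linarith
    qed
    have "\<bar>val a t - val b t\<bar> \<le> L * dist a b"
    proof (rule L(2)[OF t(1) tb])
      show "\<eta>' \<le> \<bar>t - a $ i\<bar> \<and> \<bar>t - a $ i\<bar> \<le> 1 - \<eta>'" for i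
        using ta[of i] \<eta>' \<eta>(1) far[OF ab\<rho>(1) tD, of i] by linarith
      show "\<eta>' \<le> \<bar>t - b $ i\<bar> \<and> \<bar>t - b $ i\<bar> \<le> 1 - \<eta>'" for i
        using ta[of i] abn[of i] \<eta>' far[OF ab\<rho>(2) tD, of i] by linarith
    qed
    then show "m a j \<le> m b j + L * dist a b + \<epsilon>"
      using t(2) val_le_m[OF abS(2) tb] by linarith
  qed
  show ?thesis
  proof (rule that[OF r(1) L(1)])
    show "ball x r \<subseteq> Y" using ballY r(2) subset_ball by blast
    show "\<bar>m a j - m b j\<bar> \<le> L * dist a b" if "a \<in> ball x r" "b \<in> ball x r" "j \<le> N" for a b j
      using one[OF that] one[OF that(2,1,3)] by (simp add: abs_le_iff dist_commute)
  qed
qed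

lemma Phi_locally_lipschitz:
  assumes x: "x \<in> Y"
  obtains r L where "0 < r" "0 \<le> L" "ball x r \<subseteq> Y"
    "\<And>a b. a \<in> ball x r \<Longrightarrow> b \<in> ball x r \<Longrightarrow> dist (Phi J K a) (Phi J K b) \<le> L * dist a b"
proof -
  obtain r L where rL: "0 < r" "0 \<le> L" "ball x r \<subseteq> Y"
    and L: "\<And>a b j. a \<in> ball x r \<Longrightarrow> b \<in> ball x r \<Longrightarrow> j \<le> N \<Longrightarrow> \<bar>m a j - m b j\<bar> \<le> L * dist a b"
    using m_locally_lipschitz[OF x] by metis
  have "dist (Phi J K a) (Phi J K b) \<le> real N * (2 * L) * dist a b"
    if a: "a \<in> ball x r" and b: "b \<in> ball x r" for a b
  proof -
    have "dist (Phi J K a) (Phi J K b) \<le> (\<Sum>i\<in>UNIV. \<bar>(Phi J K a - Phi J K b) $ i\<bar>)"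
      unfolding dist_norm by (rule norm_le_l1_cart)
    also have "\<dots> \<le> (\<Sum>i\<in>(UNIV::'n set). 2 * (L * dist a b))"
    proof (rule sum_mono)
      fix i
      show "\<bar>(Phi J K a - Phi J K b) $ i\<bar> \<le> 2 * (L * dist a b)"
      proof (rule index_cases[of i])
        fix p assume p: "1 \<le> p" "p \<le> N" "i = e p"
        have "a \<in> Y" "b \<in> Y" using a b rL(3) by auto
        then have "(Phi J K a - Phi J K b) $ i = (m a p - m b p) - (m a (p - 1) - m b (p - 1))"
          using p Phi_e[of a p] Phi_e[of b p] by simp
        moreover have "\<bar>m a p - m b p\<bar> \<le> L * dist a b" "\<bar>m a (p - 1) - m b (p - 1)\<bar> \<le> L * dist a b"
          using L[OF a b] p by auto
        ultimately show ?thesis by linarith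
      qed
    qed
    finally show ?thesis by (simp add: N_card)
  qed
  then show ?thesis using that[OF rL(1) _ rL(3), of "real N * (2 * L)"] rL(2) by simp
qed

section \<open>Topological consequences of the estimates\<close>

lemma open_Y: "open Y"
  unfolding open_contains_ball
proof
  fix x assume "x \<in> Y"
  then show "\<exists>r>0. ball x r \<subseteq> Y" by (rule Phi_locally_lipschitz) blast
qed

lemma continuous_on_Phi: "continuous_on Y (Phi J K)"
  unfolding continuous_on_iff
proof (intro ballI allI impI)
  fix x and \<epsilon> :: real assume x: "x \<in> Y" and "0 < \<epsilon>"
  obtain r L where rL: "0 < r" "0 \<le> L"
    and L: "\<And>a b. a \<in> ball x r \<Longrightarrow> b \<in> ball x r \<Longrightarrow> dist (Phi J K a) (Phi J K b) \<le> L * dist a b"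
    using Phi_locally_lipschitz[OF x] by metis
  have "dist (Phi J K y) (Phi J K x) < \<epsilon>" if "dist y x < min r (\<epsilon> / (L + 1))" for y
  proof -
    have "dist (Phi J K y) (Phi J K x) \<le> L * dist y x"
      using that rL(1) by (intro L) (auto simp: dist_commute)
    also have "\<dots> \<le> (L + 1) * dist y x" by (intro mult_right_mono) auto
    also have "\<dots> < \<epsilon>" using that rL(2) by (simp add: field_simps)
    finally show ?thesis .
  qed
  moreover have "0 < min r (\<epsilon> / (L + 1))" using rL \<open>0 < \<epsilon>\<close> by simp
  ultimately show "\<exists>d>0. \<forall>y\<in>Y. dist y x < d \<longrightarrow> dist (Phi J K y) (Phi J K x) < \<epsilon>"
    by blast
qed

lemma inj_on_Phi: "inj_on (Phi J K) Y"
proof (rule inj_onI)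
  fix x y assume "x \<in> Y" "y \<in> Y" "Phi J K x = Phi J K y"
  then show "x = y" using Phi_expanding[of x y] by simp
qed

section \<open>Surjectivity\<close>

lemma weight_D: "ereal (real N) < weight D"
  using field by (simp add: field_function_def D_def)

text \<open>An interior point of \<open>D\<close> off the nodes is always suitable. If there is
  none, the interior points of \<open>D\<close> are among the interior nodes. As the endpoints
  contribute at most 1 to the weight, every coordinate must then be interior and some endpoint must
  belong to \<open>D\<close>; that endpoint has distance less than 1 from each node.\<close>

lemma exists_finite_point_off_nodes:
  fixes y :: "(real, 'n) vec"
  assumes y: "\<And>i. 0 \<le> y $ i \<and> y $ i \<le> 1"
  obtains w where "w \<in> D" "\<And>i. w \<noteq> y $ i" "\<And>i. \<bar>w - y $ i\<bar> < 1"
proof (cases "\<exists>w\<in>D \<inter> {0<..<1}. \<forall>i. w \<noteq> y $ i")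
  case True
  then obtain w where w: "w \<in> D" "0 < w" "w < 1" "\<And>i. w \<noteq> y $ i" by auto
  moreover have "\<bar>w - y $ i\<bar> < 1" for i using y[of i] w(2,3) by (simp add: abs_less_iff)
  ultimately show ?thesis using that by blast
next
  case False
  define P where "P = {i. 0 < y $ i \<and> y $ i < 1}"
  define A where "A = D \<inter> {0<..<1}"
  define E where "E = D \<inter> {0, 1}"
  have A: "A \<subseteq> (\<lambda>i. y $ i) ` P"
    using False by (fastforce simp: A_def P_def)
  then have finA: "finite A" and cardA: "card A \<le> card P"
    by (auto intro: finite_subset surj_card_le)
  have finE: "finite E" and cardE: "card E \<le> 2"
    using card_mono[of "{0, 1::real}" E] by (auto simp: E_def)
  have DAE: "D = A \<union> E" and disj: "A \<inter> E = {}"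
    using D_bounds by (fastforce simp: A_def E_def)+
  have "weight D = ereal ((\<Sum>t\<in>A. if t = 0 \<or> t = 1 then 1/2 else 1) + (\<Sum>t\<in>E. if t = 0 \<or> t = 1 then 1/2 else 1))"
    unfolding weight_def DAE using finA finE disj by (simp add: sum.union_disjoint)
  moreover have "(\<Sum>t\<in>A. if t = 0 \<or> t = 1 then 1/2 else 1) = (\<Sum>t\<in>A. 1::real)"
    by (rule sum.cong) (auto simp: A_def)
  moreover have "(\<Sum>t\<in>E. if t = 0 \<or> t = 1 then 1/2 else 1) = (\<Sum>t\<in>E. 1/2::real)"
    by (rule sum.cong) (auto simp: E_def)
  ultimately have weight: "real N < real (card A) + real (card E) / 2"
    using weight_D by simp
  have "P = UNIV"
  proof (rule ccontr)
    assume "P \<noteq> UNIV"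
    then have "card P < N"
      using psubset_card_mono[of UNIV P] by (simp add: N_card psubset_eq)
    then show False using weight cardA cardE by linarith
  qed
  then have "E \<noteq> {}" using weight cardA by (auto simp: N_card)
  then obtain w where w: "w \<in> D" "w = 0 \<or> w = 1" by (auto simp: E_def)
  have inner: "0 < y $ i \<and> y $ i < 1" for i using \<open>P = UNIV\<close> by (auto simp: P_def)
  have "w \<noteq> y $ i" "\<bar>w - y $ i\<bar> < 1" for i
    using inner[of i] w(2) by auto
  with w(1) show ?thesis using that by blast
qed

lemma exists_V:
  assumes y: "y \<in> simplexS" and w: "w \<in> D" "\<And>i. w \<noteq> y $ i"
  obtains j where "j \<le> N" "w \<in> V y j"
proof -
  \<comment> \<open>The element 0 stands for the case that no node lies to the left of
    \<open>w\<close>.\<close>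
  define Q where "Q = insert 0 {p\<in>{1..N}. y $ e p < w}"
  define j where "j = Max Q"
  have Q: "finite Q" "Q \<noteq> {}" by (auto simp: Q_def)
  have jQ: "j \<in> Q" unfolding j_def by (rule Max_in[OF Q])
  then have j: "j \<le> N" by (auto simp: Q_def)
  have "y $ e p < w" if "p \<in> {1..N}" "p \<le> j" for p
  proof -
    have "y $ e j < w" using jQ that by (auto simp: Q_def)
    then show ?thesis using simplexS_mono[OF y, of p j] that j by auto
  qed
  moreover have "w < y $ e p" if "p \<in> {1..N}" "j < p" for p
  proof -
    have "p \<notin> Q" using Max_ge[OF Q(1), of p] that by (auto simp: j_def)
    then show ?thesis using that w(2)[of "e p"] by (auto simp: Q_def)
  qed
  ultimately have "w \<in> V y j" using w(1) by (auto simp: V_def)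
  with j show ?thesis by (rule that)
qed

text \<open>Neighbouring suprema differ by a component of \<open>Phi\<close>; going from
  \<open>k\<close> to \<open>j\<close> through index 0 takes at most \<open>2 * N\<close> such
  differences.\<close>

lemma m_le_m_add:
  assumes y: "y \<in> Y" and R: "norm (Phi J K y) \<le> R" and "j \<le> N" "k \<le> N"
  shows "m y k \<le> m y j + 2 * real N * R"
proof -
  have R0: "0 \<le> R" using R norm_ge_zero order_trans by blast
  have step: "\<bar>m y p - m y (p - 1)\<bar> \<le> R" if "1 \<le> p" "p \<le> N" for p
    using Phi_e[OF y that] component_le_norm_cart[of "Phi J K y" "e p"] R by simp
  have base: "\<bar>m y l - m y 0\<bar> \<le> real l * R" if "l \<le> N" for l
    using that
  proof (induction l)
    case (Suc l)
    then show ?case using step[of "Suc l"] by (simp add: algebra_simps)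
  qed simp
  have "real l * R \<le> real N * R" if "l \<le> N" for l
    using that R0 by (intro mult_right_mono) auto
  from this[OF assms(3)] this[OF assms(4)] show ?thesis
    using base[OF assms(3)] base[OF assms(4)] by linarith
qed

text \<open>By the expansion estimate, convergence of \<open>\<Phi>(y\<^sub>k)\<close> forces \<open>y\<^sub>k\<close> to converge. All
  \<open>m\<^sub>j(y\<^sub>k)\<close> are bounded below: one of them is, because the weight condition provides a point
  where the limit of \<open>F(y\<^sub>k,\<cdot>)\<close> is finite, and their differences are bounded. So near-maximum
  points keep a distance from the nodes and survive in the limit.\<close>
lemma closed_Phi_image: "closed (Phi J K ` Y)"
  unfolding closed_sequential_limits
proof (intro allI impI, elim conjE)
  fix u v assume "\<forall>k. u k \<in> Phi J K ` Y" and lim: "u \<longlonglongrightarrow> v"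
  then have "\<forall>k. \<exists>y. y \<in> Y \<and> u k = Phi J K y" by blast
  then obtain y where yY: "\<And>k. y k \<in> Y" and u: "\<And>k. u k = Phi J K (y k)" by metis
  have yS: "y k \<in> simplexS" for k using yY Y_subset_simplexS by blast
  have "Cauchy y"
    unfolding Cauchy_def
  proof (intro allI impI)
    fix \<epsilon> :: real assume "0 < \<epsilon>"
    then have "0 < \<epsilon> * c / real N" using c_pos N_pos by simp
    then obtain M where M: "\<And>k l. k \<ge> M \<Longrightarrow> l \<ge> M \<Longrightarrow> dist (u k) (u l) < \<epsilon> * c / real N"
      using LIMSEQ_imp_Cauchy[OF lim] unfolding Cauchy_def by blast
    have "dist (y k) (y l) < \<epsilon>" if "k \<ge> M" "l \<ge> M" for k l
    proof -
      have "dist (y k) (y l) \<le> real N / c * dist (u k) (u l)"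
        unfolding u by (rule Phi_expanding[OF yY yY])
      also have "\<dots> < real N / c * (\<epsilon> * c / real N)"
        using M[OF that] c_pos N_pos by (intro mult_strict_left_mono) auto
      finally show ?thesis using c_pos N_pos by simp
    qed
    then show "\<exists>M. \<forall>k\<ge>M. \<forall>l\<ge>M. dist (y k) (y l) < \<epsilon>" by blast
  qed
  then obtain x where x: "y \<longlonglongrightarrow> x"
    using Cauchy_convergent convergent_def by blast
  have xi: "(\<lambda>k. y k $ i) \<longlonglongrightarrow> x $ i" for i
    using x by (rule tendsto_vec_nth)
  have "0 \<le> x $ i \<and> x $ i \<le> 1" for i
    using LIMSEQ_le_const[OF xi[of i], of 0] LIMSEQ_le_const2[OF xi[of i], of 1] simplexS_bounds[OF yS]
    by (simp add: less_imp_le)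
  then obtain w where w: "w \<in> D" "\<And>i. w \<noteq> x $ i" "\<And>i. \<bar>w - x $ i\<bar> < 1"
    using exists_finite_point_off_nodes[of x] by metis
  have lim_val: "(\<lambda>k. val (y k) w) \<longlonglongrightarrow> val x w"
    unfolding val_def
  proof (intro tendsto_add tendsto_const tendsto_sum)
    fix i
    have "isCont (K i) (w - x $ i)"
      using w(2,3)[of i] by (intro isCont_kernel) (auto simp: abs_less_iff)
    then show "(\<lambda>k. K i (w - y k $ i)) \<longlonglongrightarrow> K i (w - x $ i)"
      by (rule isCont_tendsto_compose) (intro tendsto_intros xi)
  qed
  obtain R where R: "\<And>k. norm (u k) \<le> R"
    using Cauchy_Bseq[OF LIMSEQ_imp_Cauchy[OF lim]] unfolding Bseq_def by blast
  \<comment> \<open>One unit allows for the difference between \<open>val (y k) w\<close> and its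
    limit, the other for choosing a point within 1 of the supremum; the middle term passes from one
    interval to any other.\<close>
  define B where "B = val x w - 1 - 2 * real N * R - 1"
  obtain \<eta> where \<eta>: "0 < \<eta>"
    "\<And>y t j i. y \<in> simplexS \<Longrightarrow> t \<in> V y j \<Longrightarrow> B \<le> val y t \<Longrightarrow> \<eta> \<le> \<bar>t - y $ i\<bar>"
    using large_val_away_from_nodes[of B] by metis
  have "\<forall>\<^sub>F k in sequentially. val x w - 1 < val (y k) w"
    by (rule order_tendstoD(1)[OF lim_val]) simp
  moreover have "\<forall>\<^sub>F k in sequentially. dist (y k) x < \<eta>"
    using x \<eta>(1) by (rule tendstoD)
  moreover have "\<forall>\<^sub>F k in sequentially. \<forall>i. y k $ i \<noteq> w"
  proof (rule eventually_all_finite)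
    show "\<forall>\<^sub>F k in sequentially. y k $ i \<noteq> w" for i
      using w(2)[of i] by (intro tendsto_imp_eventually_ne[OF xi]) simp
  qed
  ultimately have "\<forall>\<^sub>F k in sequentially. val x w - 1 < val (y k) w \<and> dist (y k) x < \<eta> \<and> (\<forall>i. y k $ i \<noteq> w)"
    by eventually_elim blast
  \<comment> \<open>A single index is enough, because \<open>\<eta>\<close> is the same for all
    members of the sequence.\<close>
  then obtain k where k: "val x w - 1 < val (y k) w" "dist (y k) x < \<eta>" "\<And>i. y k $ i \<noteq> w"
    using eventually_happens'[OF sequentially_bot] by blast
  obtain j0 where j0: "j0 \<le> N" "w \<in> V (y k) j0"
    by (rule exists_V[OF yS[of k] w(1)]) (use k(3) in auto)
  \<comment> \<open>So far \<open>x\<close> is known only to lie in the closed cube. Nonemptiness of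
    all these sets also excludes that nodes collide or reach 0 or 1.\<close>
  have "V x j \<noteq> {}" if j: "j \<le> N" for j
  proof -
    obtain t where t: "t \<in> V (y k) j" "m (y k) j - 1 < val (y k) t"
      using m_approx[OF yY j, of 1 k] by auto
    have "m (y k) j0 \<le> m (y k) j + 2 * real N * R"
      using R[of k] unfolding u by (rule m_le_m_add[OF yY _ j j0(1)])
    then have "B \<le> val (y k) t"
      using t(2) val_le_m[OF yS j0(2)] k(1) unfolding B_def by linarith
    then have far: "\<eta> \<le> \<bar>t - y k $ i\<bar>" for i using \<eta>(2)[OF yS t(1)] by blast
    have "t \<in> V x j"
    proof (rule V_stable[OF t(1)])
      show "\<bar>y k $ i - x $ i\<bar> < \<bar>t - y k $ i\<bar>" for i
        using far[of i] k(2) dist_vec_nth_le[of "y k" i x] by (simp add: dist_real_def)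
    qed
    then show ?thesis by blast
  qed
  then have xY: "x \<in> Y" by (simp add: Y_def)
  have "(\<lambda>k. Phi J K (y k)) \<longlonglongrightarrow> Phi J K x"
    using continuous_on_tendsto_compose[OF continuous_on_Phi x xY] yY by simp
  with lim have "v = Phi J K x"
    unfolding u[symmetric] by (rule LIMSEQ_unique)
  then show "v \<in> Phi J K ` Y" using xY by blast
qed

text \<open>Each point has weight at most 1, so \<open>D\<close> contains \<open>N + 1\<close>
  points; placing a node midway between any two consecutive ones leaves one of them in each
  interval.\<close>

lemma Y_nonempty: "Y \<noteq> {}"
proof -
  obtain T where T: "T \<subseteq> D" "finite T" "card T = Suc N"
  proof (cases "finite D")
    case True
    have "(\<Sum>t\<in>D. if t = 0 \<or> t = 1 then 1/2 else 1) \<le> (\<Sum>t\<in>D. 1::real)"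
      by (rule sum_mono) auto
    then have "N < card D" using weight_D True by (simp add: weight_def)
    then show ?thesis using obtain_subset_with_card_n[of "Suc N" D] that by auto
  next
    case False
    then show ?thesis using infinite_arbitrarily_large[of D "Suc N"] that by blast
  qed
  obtain h where h: "bij_betw h {..<Suc N} T" "\<And>i j. i < j \<Longrightarrow> j < Suc N \<Longrightarrow> h i < h j"
    using finite_linorder_enumeration[OF T(2)] T(3) by metis
  \<comment> \<open>\<open>inv_into {1..N} e i\<close> is the position of the coordinate
    \<open>i\<close>, counted from 1, whereas \<open>h\<close> counts from 0.\<close>
  define y :: "(real, 'n) vec" where
    "y = (\<chi> i. (h (inv_into {1..N} e i - 1) + h (inv_into {1..N} e i)) / 2)"
  have y: "y $ e p = (h (p - 1) + h p) / 2" if "p \<in> {1..N}" for p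
    using that e_bij by (simp add: y_def bij_betw_def)
  have hmono: "h i \<le> h j" if "i \<le> j" "j \<le> N" for i j
    using h(2)[of i j] that by (cases "i = j") auto
  have "h j \<in> V y j" if j: "j \<le> N" for j
  proof -
    have "h j \<in> D" using h(1) T(1) j by (auto simp: bij_betw_def)
    moreover have "y $ e p < h j" if "p \<in> {1..N}" "p \<le> j" for p
      using h(2)[of "p - 1" p] hmono[of p j] that j unfolding y[OF that(1)] by auto
    moreover have "h j < y $ e p" if "p \<in> {1..N}" "j < p" for p
    proof -
      have "h j \<le> h (p - 1)" using that by (intro hmono) auto
      moreover have "h (p - 1) < h p" using that by (intro h) auto
      ultimately show ?thesis unfolding y[OF that(1)] by simp
    qed
    ultimately show ?thesis by (auto simp: V_def)
  qed
  then have "y \<in> Y" by (auto simp: Y_def)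
  then show ?thesis by blast
qed

lemma Phi_image: "Phi J K ` Y = UNIV"
proof -
  have "open (Phi J K ` Y)"
    by (rule invariance_of_domain[OF continuous_on_Phi open_Y inj_on_Phi])
  then show ?thesis
    using closed_Phi_image Y_nonempty connected_UNIV[where 'a = "(real, 'n) vec"]
    by (auto simp: connected_clopen)
qed

section \<open>The homeomorphism and its local bi-Lipschitz property\<close>

lemma homeomorphism_Phi: "\<exists>g. homeomorphism Y UNIV (Phi J K) g"
  by (rule invariance_of_domain_homeomorphism[OF open_Y continuous_on_Phi order.refl inj_on_Phi])
    (auto simp: Phi_image)

lemma locally_bilipschitz_on_Phi: "locally_bilipschitz_on Y (Phi J K)"
  unfolding locally_bilipschitz_on_def
proof
  fix x assume "x \<in> Y"
  then obtain r L where r: "0 < r" and L: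
    "\<And>a b. a \<in> ball x r \<Longrightarrow> b \<in> ball x r \<Longrightarrow> dist (Phi J K a) (Phi J K b) \<le> L * dist a b"
    using Phi_locally_lipschitz by metis
  define L' where "L' = max L (real N / c)"
  have "dist (Phi J K a) (Phi J K b) \<le> L' * dist a b \<and> dist a b \<le> L' * dist (Phi J K a) (Phi J K b)"
    if "a \<in> Y \<inter> ball x r" "b \<in> Y \<inter> ball x r" for a b
  proof
    have "L * dist a b \<le> L' * dist a b" by (intro mult_right_mono) (auto simp: L'_def)
    then show "dist (Phi J K a) (Phi J K b) \<le> L' * dist a b"
      using L[of a b] that by auto
    have "real N / c * dist (Phi J K a) (Phi J K b) \<le> L' * dist (Phi J K a) (Phi J K b)"
      by (intro mult_right_mono) (auto simp: L'_def)
    then show "dist a b \<le> L' * dist (Phi J K a) (Phi J K b)"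
      using Phi_expanding[of a b] that by auto
  qed
  then show "\<exists>r>0. \<exists>L. \<forall>a\<in>Y \<inter> ball x r. \<forall>b\<in>Y \<inter> ball x r.
      dist (Phi J K a) (Phi J K b) \<le> L * dist a b \<and> dist a b \<le> L * dist (Phi J K a) (Phi J K b)"
    using r by blast
qed

end

theorem theorem2p1:
  fixes K :: "'n::{finite,linorder} \<Rightarrow> real \<Rightarrow> real"
    and J :: "real \<Rightarrow> ereal"
    and c :: real
  assumes "c > 0"
    and "\<And>j. singular_kernel (K j)"
    and "\<And>j. PM c (K j)"
    and "field_function CARD('n) J"
  shows "(\<exists>g. homeomorphism (regY J K) UNIV (Phi J K) g)
         \<and> locally_bilipschitz_on (regY J K) (Phi J K)"
proof -
  obtain h :: "nat \<Rightarrow> 'n" where h: "bij_betw h {..<CARD('n)} UNIV"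
    "\<And>i j. i < j \<Longrightarrow> j < CARD('n) \<Longrightarrow> h i < h j"
    using finite_linorder_enumeration[OF finite[of "UNIV :: 'n set"]] by metis
  \<comment> \<open>The shift converts an enumeration from 0 into one from 1, which leaves index 0
    free for the fixed node 0.\<close>
  interpret translates K J c "CARD('n)" "\<lambda>p. h (p - 1)"
  proof
    have "bij_betw (\<lambda>p. p - 1) {1..CARD('n)} {..<CARD('n)}"
      by (rule bij_betw_byWitness[where f' = Suc]) auto
    then show "bij_betw (\<lambda>p. h (p - 1)) {1..CARD('n)} UNIV"
      using bij_betw_trans[OF _ h(1)] by (simp add: comp_def)
    show "h (p - 1) < h (q - 1)" if "1 \<le> p" "p < q" "q \<le> CARD('n)" for p q
      using that by (intro h) auto
  qed (use assms in auto)
  show ?thesis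
    unfolding regY_eq using homeomorphism_Phi locally_bilipschitz_on_Phi by blast
qed

end
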